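(* Let $\theta_1$ and $\theta_2$ be integers with $\theta_1\geqslant 1$ and $\theta_2\leqslant -2$. Suppose $\mathcal Q$ is a QSD with parameters $(v,k,\lambda;b,r,\{x,y\})$ where $\mathsf B_x(\mathcal Q)\in\mathscr G_3(e_0,e_1,e_2)$ and $$(x,y)=\bigl(k+(\theta_1+1)(\theta_2+1)-(e_1+1)(e_2+1),\;k+\theta_1\theta_2-e_1e_2\bigr).$$ (i) If $\lambda=r+\theta_1\theta_2$, $\frac{r-\lambda+y-k}{x-y}=\theta_1+\theta_2$, and $\frac{\lambda k-yr}{x-y}=\sqrt{\lambda(k+e_0+\theta_1\theta_2)}$, then $$\mathsf T_x(\mathcal Q)\in\mathscr G_3(e_0-\theta_2,\theta_1,\theta_2).$$ Furthermore, if $r\neq k+e_0$ then $\mathsf T_x(\mathcal Q)$ has coherent rank $9$. (ii) If $\lambda=r+(\theta_1+1)(\theta_2+1)$, $\frac{r-\lambda+y-k}{x-y}=\theta_1+\theta_2+1$, and $$k+\frac{\lambda k-yr}{x-y}=\sqrt{(v-1+r+\theta_1\theta_2)(k+e_0+\theta_1\theta_2)},$$ then $$\mathsf W_x(\mathcal Q)\in\mathscr G_3\left(\frac{v-1+e_0+\sqrt{(v-1-e_0)^2+4rk}}{2},\theta_1,\theta_2\right).$$ Furthermore, if $v-1+r\neq k+e_0$ then $\mathsf W_x(\mathcal Q)$ has coherent rank $9$.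
   Context: All graphs are finite, undirected and simple; eigenvalues are those of the adjacency matrix $A(\Gamma)$. $\mathscr G_3(\theta_0,\theta_1,\theta_2)$, for $\theta_0>\theta_1>\theta_2$, is the set of connected graphs whose distinct eigenvalues are precisely $\theta_0,\theta_1,\theta_2$. $I$, $J$, $O$ are the identity, all-ones and zero matrices. A $2$-$(v,k,\lambda)$ design is a set $\mathcal P$ of $v$ points with a family $\mathcal B$ of $k$-subsets (blocks; repetitions allowed) such that every pair of distinct points lies in exactly $\lambda$ blocks; $b=|\mathcal B|$ and $r$ is the number of blocks containing any given point. It is quasi-symmetric with intersection numbers $x\neq y$ if every two blocks meet in $x$ or $y$ points and both occur; it is then called a QSD with parameters $(v,k,\lambda;b,r,\{x,y\})$. The incidence matrix $M$ has rows indexed by points and columns by blocks, with entry $1$ if the point is in the block and $0$ otherwise. The $x$-block graph $\mathsf B_x(\mathcal Q)$ has the blocks as vertices, two blocks being adjacent when they meet in $x$ points. The $x$-total graph $\mathsf T_x(\mathcal Q)$ and the $x$-whole graph $\mathsf W_x(\mathcal Q)$ are the graphs with adjacency matrices $$\begin{bmatrix}O&M\\ M^\top&A(\mathsf B_x(\mathcal Q))\end{bmatrix}\quad\text{and}\quad\begin{bmatrix}J-I&M\\ M^\top&A(\mathsf B_x(\mathcal Q))\end{bmatrix}$$ respectively. A coherent algebra on a finite set $X$ is a matrix algebra $\mathcal A\subset \operatorname{Mat}_X(\mathbb C)$ containing $I$ and $J$ and closed under transposition, ordinary multiplication and entrywise multiplication. It has a unique linear basis of $\{0,1\}$-matrices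 summing to $J$, whose size is the rank. The coherent rank of a graph $\Gamma$ is the rank of its coherent closure $\mathcal W(\Gamma)$, the smallest coherent algebra containing $A(\Gamma)$. *)

theory Defs
  imports "HOL-Analysis.Analysis"
begin

section \<open>Graphs and their eigenvalues\<close>

text \<open>A graph is given by its adjacency relation; the vertex set is the whole (finite) type.\<close>

type_synonym 'a graph = "'a \<Rightarrow> 'a \<Rightarrow> bool"

definition simple_graph :: "'a graph \<Rightarrow> bool" where
  "simple_graph E \<longleftrightarrow> symp E \<and> irreflp E"

definition connected_graph :: "'a graph \<Rightarrow> bool" where
  "connected_graph E \<longleftrightarrow> (\<forall>u w. E\<^sup>*\<^sup>* u w)"

definition adjacency_matrix :: "'a graph \<Rightarrow> complex^'a^'a" where
  "adjacency_matrix E = (\<chi> u w. if E u w then 1 else 0)"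

definition graph_of_matrix :: "complex^'a^'a \<Rightarrow> 'a graph" where
  "graph_of_matrix A = (\<lambda>u w. A $ u $ w = 1)"

definition eigenvalues :: "complex^'a^'a \<Rightarrow> complex set" where
  "eigenvalues A = {c. \<exists>u. u \<noteq> 0 \<and> A *v u = c *s u}"

definition G3 :: "real \<Rightarrow> real \<Rightarrow> real \<Rightarrow> ('a::finite) graph set" where
  "G3 t0 t1 t2 = {E. t0 > t1 \<and> t1 > t2 \<and> simple_graph E \<and> connected_graph E \<and>
     eigenvalues (adjacency_matrix E) = {complex_of_real t0, complex_of_real t1, complex_of_real t2}}"


section \<open>Quasi-symmetric designs\<close>

text \<open>
  The points are the elements of the type \<open>'p\<close>. The blocks form a family indexed by the type
  \<open>'b\<close>, so that a block may be repeated, and \<open>Q j\<close> is the point set of the block with index \<open>j\<close>.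
\<close>

definition design2 :: "('b::finite \<Rightarrow> 'p::finite set) \<Rightarrow> nat \<Rightarrow> nat \<Rightarrow> nat \<Rightarrow> bool" where
  "design2 Q v k lam \<longleftrightarrow>
     CARD('p) = v \<and>
     (\<forall>j. card (Q j) = k) \<and>
     (\<forall>p q. p \<noteq> q \<longrightarrow> card {j. p \<in> Q j \<and> q \<in> Q j} = lam)"

definition quasi_symmetric :: "('b \<Rightarrow> 'p set) \<Rightarrow> nat \<Rightarrow> nat \<Rightarrow> bool" where
  "quasi_symmetric Q x y \<longleftrightarrow>
     x \<noteq> y \<and>
     (\<forall>i j. i \<noteq> j \<longrightarrow> card (Q i \<inter> Q j) = x \<or> card (Q i \<inter> Q j) = y) \<and>
     (\<exists>i j. i \<noteq> j \<and> card (Q i \<inter> Q j) = x) \<and>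
     (\<exists>i j. i \<noteq> j \<and> card (Q i \<inter> Q j) = y)"

definition QSD :: "('b::finite \<Rightarrow> 'p::finite set) \<Rightarrow>
    nat \<Rightarrow> nat \<Rightarrow> nat \<Rightarrow> nat \<Rightarrow> nat \<Rightarrow> nat \<Rightarrow> nat \<Rightarrow> bool" where
  "QSD Q v k lam b r x y \<longleftrightarrow>
     design2 Q v k lam \<and>
     CARD('b) = b \<and>
     (\<forall>p. card {j. p \<in> Q j} = r) \<and>
     quasi_symmetric Q x y"

definition incidence_matrix :: "('b \<Rightarrow> 'p set) \<Rightarrow> complex^'b^'p" where
  "incidence_matrix Q = (\<chi> p j. if p \<in> Q j then 1 else 0)"

text \<open>
  The condition \<open>i \<noteq> j\<close> matters: if \<open>x = k\<close>, then two repeated blocks (distinct indices) are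
  adjacent, but no block is adjacent to itself.
\<close>

definition block_graph :: "nat \<Rightarrow> ('b \<Rightarrow> 'p set) \<Rightarrow> 'b graph" where
  "block_graph x Q = (\<lambda>i j. i \<noteq> j \<and> card (Q i \<inter> Q j) = x)"

definition all_ones :: "complex^'n^'m" where
  "all_ones = (\<chi> i j. 1)"

definition block_matrix ::
  "complex^'m^'m \<Rightarrow> complex^'n^'m \<Rightarrow> complex^'m^'n \<Rightarrow> complex^'n^'n \<Rightarrow> complex^('m + 'n)^('m + 'n)"
  where
  "block_matrix A B C D = (\<chi> s t.
     case s of
       Inl i \<Rightarrow> (case t of Inl j \<Rightarrow> A $ i $ j | Inr j \<Rightarrow> B $ i $ j)
     | Inr i \<Rightarrow> (case t of Inl j \<Rightarrow> C $ i $ j | Inr j \<Rightarrow> D $ i $ j))"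

definition total_matrix :: "nat \<Rightarrow> ('b::finite \<Rightarrow> 'p::finite set) \<Rightarrow> complex^('p + 'b)^('p + 'b)" where
  "total_matrix x Q = block_matrix
     0                                (incidence_matrix Q)
     (transpose (incidence_matrix Q)) (adjacency_matrix (block_graph x Q))"

definition whole_matrix :: "nat \<Rightarrow> ('b::finite \<Rightarrow> 'p::finite set) \<Rightarrow> complex^('p + 'b)^('p + 'b)" where
  "whole_matrix x Q = block_matrix
     (all_ones - mat 1)               (incidence_matrix Q)
     (transpose (incidence_matrix Q)) (adjacency_matrix (block_graph x Q))"

definition total_graph :: "nat \<Rightarrow> ('b::finite \<Rightarrow> 'p::finite set) \<Rightarrow> ('p + 'b) graph" where
  "total_graph x Q = graph_of_matrix (total_matrix x Q)"

definition whole_graph :: "nat \<Rightarrow> ('b::finite \<Rightarrow> 'p::finite set) \<Rightarrow> ('p + 'b) graph" where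
  "whole_graph x Q = graph_of_matrix (whole_matrix x Q)"

lemma adjacency_matrix_total_graph:
  "adjacency_matrix (total_graph x Q) = total_matrix x Q"
  by (auto simp: vec_eq_iff adjacency_matrix_def total_graph_def graph_of_matrix_def
      total_matrix_def block_matrix_def incidence_matrix_def transpose_def split: sum.split)

lemma adjacency_matrix_whole_graph:
  "adjacency_matrix (whole_graph x Q) = whole_matrix x Q"
  by (auto simp: vec_eq_iff adjacency_matrix_def whole_graph_def graph_of_matrix_def
      whole_matrix_def block_matrix_def incidence_matrix_def transpose_def all_ones_def mat_def
      split: sum.split)


section \<open>Coherent algebras\<close>

definition cscale :: "complex \<Rightarrow> complex^'n^'m \<Rightarrow> complex^'n^'m" where
  "cscale c A = (\<chi> i j. c * A $ i $ j)"

global_interpretation cmat: vector_space cscale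
  by unfold_locales (simp_all add: cscale_def vec_eq_iff algebra_simps)

definition hadamard :: "complex^'n^'m \<Rightarrow> complex^'n^'m \<Rightarrow> complex^'n^'m" where
  "hadamard A B = (\<chi> i j. A $ i $ j * B $ i $ j)"

definition coherent_algebra :: "(complex^'a^'a) set \<Rightarrow> bool" where
  "coherent_algebra \<A> \<longleftrightarrow>
     cmat.subspace \<A> \<and>
     mat 1 \<in> \<A> \<and>
     all_ones \<in> \<A> \<and>
     (\<forall>A\<in>\<A>. transpose A \<in> \<A>) \<and>
     (\<forall>A\<in>\<A>. \<forall>B\<in>\<A>. A ** B \<in> \<A>) \<and>
     (\<forall>A\<in>\<A>. \<forall>B\<in>\<A>. hadamard A B \<in> \<A>)"

definition is_standard_basis :: "(complex^'a^'a) set \<Rightarrow> (complex^'a^'a) set \<Rightarrow> bool" where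
  "is_standard_basis S \<A> \<longleftrightarrow>
     cmat.independent S \<and>
     cmat.span S = \<A> \<and>
     (\<forall>C\<in>S. \<forall>i j. C $ i $ j = 0 \<or> C $ i $ j = 1) \<and>
     \<Sum>S = all_ones"

definition standard_basis :: "(complex^'a^'a) set \<Rightarrow> (complex^'a^'a) set" where
  "standard_basis \<A> = (THE S. is_standard_basis S \<A>)"

definition algebra_rank :: "(complex^'a^'a) set \<Rightarrow> nat" where
  "algebra_rank \<A> = card (standard_basis \<A>)"

definition coherent_closure :: "('a::finite) graph \<Rightarrow> (complex^'a^'a) set" where
  "coherent_closure E = \<Inter>{\<A>. coherent_algebra \<A> \<and> adjacency_matrix E \<in> \<A>}"

definition coherent_rank :: "('a::finite) graph \<Rightarrow> nat" where
  "coherent_rank E = algebra_rank (coherent_closure E)"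

lemma coherent_algebra_coherent_closure:
  "coherent_algebra (coherent_closure E)"
  by (auto simp: coherent_algebra_def coherent_closure_def intro!: cmat.subspace_Inter)

text \<open>The description in \<open>standard_basis_def\<close> is proper for every coherent algebra.\<close>

lemma standard_basis_unique_aux:
  assumes S: "is_standard_basis S \<A>" and T: "is_standard_basis T \<A>"
  shows "S \<subseteq> T"
proof
  have fin: "finite R" and cov: "\<And>i j. (\<Sum>C\<in>R. C $ i $ j) = 1"
    and zo: "\<And>C i j. C \<in> R \<Longrightarrow> C $ i $ j = 0 \<or> C $ i $ j = 1"
    and nz: "0 \<notin> R"
    if R: "is_standard_basis R \<A>" for R
  proof -
    show f: "finite R"
    proof (rule ccontr)
      assume "infinite R"
      then have "\<Sum>R = 0" by simp
      then have "(all_ones :: complex^'a^'a) = 0" using R by (simp add: is_standard_basis_def)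
      then show False by (simp add: all_ones_def vec_eq_iff)
    qed
    have "(\<Sum>R) $ i $ j = (\<Sum>C\<in>R. C $ i $ j)" for i j by (simp add: sum_component)
    moreover have "\<Sum>R = all_ones" using R by (simp add: is_standard_basis_def)
    ultimately show "(\<Sum>C\<in>R. C $ i $ j) = 1" for i j
      by (metis all_ones_def vec_lambda_beta)
    show "C $ i $ j = 0 \<or> C $ i $ j = 1" if "C \<in> R" for C i j
      using R that by (simp add: is_standard_basis_def)
    show "0 \<notin> R" using R cmat.dependent_zero by (auto simp: is_standard_basis_def)
  qed
  have ex1: "\<exists>C\<in>R. C $ i $ j = 1" if R: "is_standard_basis R \<A>" for R i j
  proof (rule ccontr)
    assume "\<not> ?thesis"
    then have "(\<Sum>C\<in>R. C $ i $ j) = 0" using zo[OF R] by (intro sum.neutral) blast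
    then show False using cov[OF R] by simp
  qed
  have uni: "C = D" if R: "is_standard_basis R \<A>" and "C \<in> R" "D \<in> R"
    "C $ i $ j = 1" "D $ i $ j = 1" for R C D i j
  proof (rule ccontr)
    assume "C \<noteq> D"
    let ?f = "\<lambda>C. Re (C $ i $ j)"
    have "(\<Sum>X\<in>{C,D}. ?f X) \<le> (\<Sum>X\<in>R. ?f X)"
    proof (intro sum_mono2)
      fix X assume "X \<in> R - {C, D}"
      then show "0 \<le> ?f X" using zo[OF R, of X i j] by auto
    qed (use that fin[OF R] in auto)
    also have "\<dots> = Re (\<Sum>X\<in>R. X $ i $ j)" by simp
    finally show False using cov[OF R] \<open>C \<noteq> D\<close> that by simp
  qed
  have const: "C $ i $ j = C $ i' $ j'"
    if R: "is_standard_basis R \<A>" and "C \<in> \<A>" "D \<in> R" "D $ i $ j = 1" "D $ i' $ j' = 1"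
    for R C D i j i' j'
  proof -
    have sub: "cmat.subspace {X :: complex^'a^'a. X $ i $ j = X $ i' $ j'}"
      by (simp add: cmat.subspace_def cscale_def)
    have "R \<subseteq> {X. X $ i $ j = X $ i' $ j'}"
      using uni[OF R] zo[OF R] that by (smt (verit, ccfv_SIG) mem_Collect_eq subsetI)
    then have "cmat.span R \<subseteq> {X. X $ i $ j = X $ i' $ j'}"
      using sub by (intro cmat.span_minimal)
    then show ?thesis using that by (auto simp: is_standard_basis_def)
  qed
  fix C assume C: "C \<in> S"
  then have "C \<noteq> 0" using nz[OF S] by auto
  then obtain i j where ij: "C $ i $ j = 1"
    using zo[OF S C] by (force simp: vec_eq_iff)
  obtain D where D: "D \<in> T" "D $ i $ j = 1" using ex1[OF T] by blast
  have inA: "X \<in> \<A>" if "X \<in> S \<or> X \<in> T" for X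
    using that S T cmat.span_base by (auto simp: is_standard_basis_def)
  have "C $ a $ c = D $ a $ c" for a c
    using zo[OF S C, of a c] zo[OF T D(1), of a c]
      const[OF S _ C, of D a c i j] const[OF T _ D(1), of C a c i j] inA C D ij
    by auto
  then have "C = D" by (simp add: vec_eq_iff)
  then show "C \<in> T" using D by simp
qed

lemma ex1_standard_basis:
  assumes A: "coherent_algebra (\<A> :: (complex^'a^'a) set)"
  shows "\<exists>!S. is_standard_basis S \<A>"
proof -
  have sub: "cmat.subspace \<A>" and had: "\<And>X Y. X \<in> \<A> \<Longrightarrow> Y \<in> \<A> \<Longrightarrow> hadamard X Y \<in> \<A>"
    and one: "all_ones \<in> \<A>"
    using A by (auto simp: coherent_algebra_def)
  define eq where "eq = (\<lambda>(p :: 'a \<times> 'a) q. \<forall>X\<in>\<A>. X $ fst p $ snd p = X $ fst q $ snd q)"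
  define ind :: "'a \<times> 'a \<Rightarrow> complex^'a^'a"
    where "ind = (\<lambda>p. \<chi> i j. if eq p (i, j) then 1 else 0)"
  have eq_refl: "eq p p" for p by (simp add: eq_def)
  have eq_ind: "ind p = ind q" if "eq p q" for p q
    using that by (simp add: ind_def eq_def vec_eq_iff)
  have ind_in: "ind p \<in> \<A>" for p
  proof -
    have "\<exists>X\<in>\<A>. X $ fst p $ snd p = 1 \<and> (\<forall>q\<in>Q. \<not> eq p q \<longrightarrow> X $ fst q $ snd q = 0)"
      if "finite Q" for Q using that
    proof (induction Q)
      case empty
      show ?case using one by (auto simp: all_ones_def intro!: bexI[of _ all_ones])
    next
      case (insert q Q)
      then obtain X where X: "X \<in> \<A>" "X $ fst p $ snd p = 1"
        "\<And>q. q \<in> Q \<Longrightarrow> \<not> eq p q \<Longrightarrow> X $ fst q $ snd q = 0" by blast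
      show ?case
      proof (cases "eq p q")
        case True
        then show ?thesis using X by (intro bexI[of _ X]) auto
      next
        case False
        then obtain Y where Y: "Y \<in> \<A>" "Y $ fst p $ snd p \<noteq> Y $ fst q $ snd q"
          by (auto simp: eq_def)
        define c where "c = Y $ fst q $ snd q"
        define Z where "Z = cscale (inverse (Y $ fst p $ snd p - c)) (Y - cscale c all_ones)"
        have Zin: "Z \<in> \<A>" unfolding Z_def using Y one sub
          by (intro cmat.subspace_scale cmat.subspace_diff) auto
        have Z: "Z $ fst p $ snd p = 1" "Z $ fst q $ snd q = 0"
          using Y by (auto simp: Z_def cscale_def c_def all_ones_def)
        show ?thesis using X Z Zin had
          by (intro bexI[of _ "hadamard X Z"]) (auto simp: hadamard_def)
      qed
    qed
    from this[of UNIV] obtain X where X: "X \<in> \<A>" "X $ fst p $ snd p = 1"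
      "\<And>q. \<not> eq p q \<Longrightarrow> X $ fst q $ snd q = 0" by auto
    have "X $ i $ j = ind p $ i $ j" for i j
    proof (cases "eq p (i, j)")
      case True
      then have "X $ fst p $ snd p = X $ i $ j" using X(1) by (auto simp: eq_def)
      then show ?thesis using X(2) True by (simp add: ind_def)
    next
      case False
      then show ?thesis using X(3)[of "(i, j)"] by (simp add: ind_def)
    qed
    then have "X = ind p" by (simp add: vec_eq_iff)
    then show ?thesis using X by simp
  qed
  let ?S = "range ind"
  have val: "ind q $ fst p $ snd p = (if ind q = ind p then 1 else 0)" for p q
  proof (cases "eq q p")
    case True
    then have "ind q $ fst p $ snd p = 1" by (simp add: ind_def)
    then show ?thesis using eq_ind[OF True] by simp
  next
    case False
    have "ind p $ fst p $ snd p = 1" using eq_refl by (simp add: ind_def)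
    moreover have "ind q $ fst p $ snd p = 0" using False by (simp add: ind_def)
    ultimately show ?thesis by auto
  qed
  have comb: "(\<Sum>C\<in>?S. cscale (u C) C) $ fst p $ snd p = u (ind p)" for u p
  proof -
    have "(\<Sum>C\<in>?S. cscale (u C) C) $ fst p $ snd p = (\<Sum>C\<in>?S. u C * C $ fst p $ snd p)"
      by (simp add: sum_component cscale_def)
    also have "\<dots> = (\<Sum>C\<in>?S. if C = ind p then u C else 0)"
      by (intro sum.cong) (auto simp: val)
    also have "\<dots> = u (ind p)" by simp
    finally show ?thesis .
  qed
  have "cmat.independent ?S"
  proof (rule cmat.independent_if_scalars_zero)
    fix u C assume "(\<Sum>C\<in>?S. cscale (u C) C) = 0" and "C \<in> ?S"
    then show "u C = 0" using comb[of u] by auto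
  qed simp
  moreover have "cmat.span ?S = \<A>"
  proof
    show "cmat.span ?S \<subseteq> \<A>" using ind_in sub by (intro cmat.span_minimal) auto
    show "\<A> \<subseteq> cmat.span ?S"
    proof
      fix X assume X: "X \<in> \<A>"
      define u where "u = (\<lambda>C. X $ fst (inv ind C) $ snd (inv ind C))"
      have "u (ind p) = X $ fst p $ snd p" for p
      proof -
        have "ind (inv ind (ind p)) = ind p" by (simp add: f_inv_into_f)
        then have "ind (inv ind (ind p)) $ fst p $ snd p = 1" using val by simp
        then have "eq (inv ind (ind p)) p" by (auto simp: ind_def split: if_splits)
        then show ?thesis using X by (auto simp: u_def eq_def)
      qed
      then have "X $ i $ j = (\<Sum>C\<in>?S. cscale (u C) C) $ i $ j" for i j
        using comb[of u "(i, j)"] by simp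
      then have "X = (\<Sum>C\<in>?S. cscale (u C) C)" by (simp add: vec_eq_iff)
      then show "X \<in> cmat.span ?S"
        by (auto intro!: cmat.span_sum cmat.span_scale intro: cmat.span_base)
    qed
  qed
  moreover have "\<Sum>?S = all_ones"
  proof -
    have "(\<Sum>?S) $ i $ j = 1" for i j
      using comb[of "\<lambda>_. 1" "(i, j)"] by (simp add: cscale_def)
    then show ?thesis by (simp add: vec_eq_iff all_ones_def)
  qed
  ultimately have "is_standard_basis ?S \<A>"
    by (auto simp: is_standard_basis_def ind_def)
  then show ?thesis
    using standard_basis_unique_aux by (metis subset_antisym)
qed

end

theory Submission
  imports Defs
begin

text \<open>
  The total graph and the whole graph are treated together: their adjacency matrix \<open>W\<close> has the
  blocks \<open>\<kappa> (J - I)\<close>, \<open>M\<close>, \<open>transpose M\<close> and \<open>B\<close>, where \<open>J\<close> is the all-ones matrix, \<open>M\<close> the incidence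
  matrix, \<open>B\<close> the adjacency matrix of the block graph, and \<open>\<kappa> = 0\<close> or \<open>\<kappa> = 1\<close>.

  From the two products of \<open>M\<close> and its transpose one obtains \<open>M B = \<psi> M + \<beta> J\<close> and
  \<open>B\<^sup>2 = (\<phi> + \<psi>) B - \<phi> \<psi> I + (e\<^sub>0 + \<phi> \<psi>) J\<close> with explicit numbers \<open>\<phi>\<close>, \<open>\<psi>\<close>, \<open>\<beta>\<close>
  (\<open>incidence_mult_block_adjacency\<close>, \<open>block_adjacency_square\<close>). The block graph is regular of degree \<open>e\<^sub>0\<close>,
  and \<open>e\<^sub>1\<close>, \<open>e\<^sub>2\<close> are \<open>\<phi>\<close> and \<open>\<psi>\<close> in some order. The hypotheses say that \<open>\<psi> = \<theta>\<^sub>1 + \<theta>\<^sub>2 + \<kappa>\<close> and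
  that \<open>\<phi>\<close> is \<open>\<theta>\<^sub>1\<close> or \<open>\<theta>\<^sub>2\<close> (\<open>phi_theta\<close>).

  A vector \<open>z\<close> on the points with zero sum, extended by a suitable multiple of \<open>transpose M z\<close> on the
  blocks, is an eigenvector of \<open>W\<close> for \<open>\<theta>\<^sub>1\<close>, and with another multiple
  one for \<open>\<theta>\<^sub>2\<close> (\<open>eigenvalue_zero_sum\<close>). Eliminating the block entries from an eigenvector equation shows that every eigenvector for another eigenvalue is constant
  on the points and on the blocks, so that the eigenvalue belongs to the quotient matrix with rows
  \<open>(\<kappa> (v - 1), r)\<close> and \<open>(k, e\<^sub>0)\<close> (\<open>eigenvalue_cases\<close>). The square-root condition forces one eigenvalue of the
  quotient matrix to be \<open>\<theta>\<^sub>1\<close> or \<open>\<theta>\<^sub>2\<close>; the other one, \<open>\<theta>\<^sub>0\<close>, is larger than \<open>\<theta>\<^sub>1\<close>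
  (\<open>quotient_eigenvalues\<close>).

  For the coherent rank, the product formulas show that the matrices constant on nine natural
  relations between points and blocks form a coherent algebra (\<open>coherent_algebra_colour_algebra\<close>). If points
  and blocks have different degrees, then \<open>W J\<close> separates them, and every coherent algebra containing \<open>W\<close>
  contains all of these matrices (\<open>colour_algebra_minimal\<close>).
\<close>

section \<open>Matrices and block matrices\<close>

lemma cscale_nth [simp]: "cscale c A $ i $ j = c * A $ i $ j"
  by (simp add: cscale_def)

lemma all_ones_nth [simp]: "all_ones $ i $ j = 1"
  by (simp add: all_ones_def)

lemma transpose_nth [simp]: "transpose A $ i $ j = A $ j $ i"
  by (simp add: transpose_def)

lemma mat_one_nth [simp]: "(mat 1 :: 'c::zero_neq_one^'n^'n) $ i $ j = (if i = j then 1 else 0)"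
  by (simp add: mat_def)

lemma cscale_mult_left: "cscale c A ** B = cscale c (A ** B)"
  by (simp add: vec_eq_iff matrix_matrix_mult_def sum_distrib_left mult_ac)

lemma cscale_mult_right: "A ** cscale c B = cscale c (A ** B)"
  by (simp add: vec_eq_iff matrix_matrix_mult_def sum_distrib_left mult_ac)

lemma matrix_add_rdistrib: "(A + B) ** C = A ** C + B ** (C :: complex^'l^'n)"
  by (simp add: vec_eq_iff matrix_matrix_mult_def ring_distribs sum.distrib)

lemmas matrix_linear_simps =
  matrix_add_ldistrib matrix_add_rdistrib cscale_mult_left cscale_mult_right

lemma all_ones_mult_all_ones:
  "(all_ones :: complex^'n^'m) ** (all_ones :: complex^'l^'n) = cscale (of_nat CARD('n)) all_ones"
  by (simp add: vec_eq_iff matrix_matrix_mult_def)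

lemma sum_UNIV_sum:
  fixes h :: "'m::finite + 'n::finite \<Rightarrow> 'c::comm_monoid_add"
  shows "(\<Sum>s\<in>UNIV. h s) = (\<Sum>i\<in>UNIV. h (Inl i)) + (\<Sum>j\<in>UNIV. h (Inr j))"
  unfolding UNIV_Plus_UNIV[symmetric] by (subst sum.Plus) (simp_all add: comp_def)

lemma block_matrix_nth [simp]:
  "block_matrix A B C D $ Inl i $ Inl i' = A $ i $ i'"
  "block_matrix A B C D $ Inl i $ Inr j' = B $ i $ j'"
  "block_matrix A B C D $ Inr j $ Inl i' = C $ j $ i'"
  "block_matrix A B C D $ Inr j $ Inr j' = D $ j $ j'"
  by (simp_all add: block_matrix_def)

lemma block_matrix_eqI:
  assumes "\<And>i i'. X $ Inl i $ Inl i' = Y $ Inl i $ Inl i'"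
    and "\<And>i j. X $ Inl i $ Inr j = Y $ Inl i $ Inr j"
    and "\<And>i j. X $ Inr j $ Inl i = Y $ Inr j $ Inl i"
    and "\<And>j j'. X $ Inr j $ Inr j' = Y $ Inr j $ Inr j'"
  shows "X = Y"
proof -
  have "X $ s $ t = Y $ s $ t" for s t
    by (cases s; cases t) (simp_all add: assms)
  then show ?thesis by (simp add: vec_eq_iff)
qed

lemma block_matrix_mult:
  "block_matrix A B C D ** block_matrix A' B' C' D' =
    block_matrix (A ** A' + B ** C') (A ** B' + B ** D') (C ** A' + D ** C') (C ** B' + D ** D')"
  by (rule block_matrix_eqI) (simp_all add: matrix_matrix_mult_def sum_UNIV_sum)

section \<open>Ranks of algebras given by colourings\<close>

text \<open>If an algebra consists of all matrices that are constant on the colour classes of pairs of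
  indices, then the indicator matrices of the classes form its standard basis.\<close>

lemma algebra_rank_colouring:
  fixes col :: "'a::finite \<Rightarrow> 'a \<Rightarrow> 'c"
  assumes \<A>: "\<And>X. X \<in> \<A> \<longleftrightarrow> (\<exists>g. \<forall>s t. X $ s $ t = g (col s t))"
  shows "algebra_rank \<A> = card (range (\<lambda>(s, t). col s t))"
proof -
  define R where "R = range (\<lambda>(s, t). col s t)"
  define C :: "'c \<Rightarrow> complex^'a^'a" where "C = (\<lambda>c. \<chi> s t. if col s t = c then 1 else 0)"
  have finR: "finite R" by (simp add: R_def)
  have col_in: "col s t \<in> R" for s t by (auto simp: R_def intro: rev_image_eqI[of "(s, t)"])
  have inj: "inj_on C R"
  proof (rule inj_onI)
    fix c c' assume "c \<in> R" and eq: "C c = C c'"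
    then obtain s t where "c = col s t" by (auto simp: R_def)
    then have "C c $ s $ t = 1" by (simp add: C_def)
    then have "C c' $ s $ t = 1" using eq by simp
    then show "c = c'" using \<open>c = col s t\<close> by (auto simp: C_def split: if_splits)
  qed
  have comb: "(\<Sum>X\<in>C ` R. cscale (u X) X) $ s $ t = u (C (col s t))" for u s t
  proof -
    have "(\<Sum>X\<in>C ` R. cscale (u X) X) $ s $ t = (\<Sum>c\<in>R. u (C c) * C c $ s $ t)"
      by (simp add: sum.reindex[OF inj])
    also have "\<dots> = (\<Sum>c\<in>R. if c = col s t then u (C c) else 0)"
      by (intro sum.cong) (auto simp: C_def)
    also have "\<dots> = u (C (col s t))" using finR col_in by simp
    finally show ?thesis .
  qed
  have "is_standard_basis (C ` R) \<A>"
    unfolding is_standard_basis_def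
  proof (intro conjI)
    show "cmat.independent (C ` R)"
    proof (rule cmat.independent_if_scalars_zero)
      fix u X assume "(\<Sum>X\<in>C ` R. cscale (u X) X) = 0" and "X \<in> C ` R"
      moreover then obtain s t where "X = C (col s t)" by (auto simp: R_def)
      ultimately show "u X = 0" using comb[of u s t] by simp
    qed (use finR in simp)
    show "cmat.span (C ` R) = \<A>"
    proof (intro equalityI subsetI)
      fix X assume "X \<in> cmat.span (C ` R)"
      then obtain u where "X = (\<Sum>Y\<in>C ` R. cscale (u Y) Y)"
        using finR by (auto simp: cmat.span_finite)
      then have "X $ s $ t = u (C (col s t))" for s t by (simp only: comb)
      then show "X \<in> \<A>" unfolding \<A> by (intro exI[of _ "\<lambda>c. u (C c)"]) blast
    next
      fix X assume "X \<in> \<A>"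
      then obtain g where g: "X $ s $ t = g (col s t)" for s t unfolding \<A> by blast
      have "X $ s $ t = (\<Sum>Y\<in>C ` R. cscale (g (the_inv_into R C Y)) Y) $ s $ t" for s t
        by (simp only: comb g the_inv_into_f_f[OF inj col_in])
      then have "X = (\<Sum>Y\<in>C ` R. cscale (g (the_inv_into R C Y)) Y)"
        unfolding vec_eq_iff by blast
      then show "X \<in> cmat.span (C ` R)"
        by (auto intro!: cmat.span_sum cmat.span_scale intro: cmat.span_base)
    qed
    show "\<forall>X\<in>C ` R. \<forall>s t. X $ s $ t = 0 \<or> X $ s $ t = 1" by (auto simp: C_def)
    have "\<Sum>(C ` R) = (\<Sum>X\<in>C ` R. cscale 1 X)" by simp
    also have "\<dots> = all_ones" unfolding vec_eq_iff using comb[of "\<lambda>_. 1"] by simp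
    finally show "\<Sum>(C ` R) = all_ones" .
  qed
  then have "standard_basis \<A> = C ` R"
    unfolding standard_basis_def
    by (rule the_equality) (metis \<open>is_standard_basis (C ` R) \<A>\<close> standard_basis_unique_aux subset_antisym)
  then show ?thesis
    unfolding R_def[symmetric] by (simp add: algebra_rank_def card_image[OF inj])
qed

section \<open>Quasi-symmetric designs\<close>

locale quasi_symmetric_design =
  fixes Q :: "'b::finite \<Rightarrow> 'p::finite set" and v k lam b r x y :: nat
  assumes qsd: "QSD Q v k lam b r x y"
begin

abbreviation M :: "complex^'b^'p" where "M \<equiv> incidence_matrix Q"
abbreviation B :: "complex^'b^'b" where "B \<equiv> adjacency_matrix (block_graph x Q)"

text \<open>On vectors with zero sum, \<open>transpose M ** M\<close> acts as \<open>(k - y) I + (x - y) B\<close> and has no eigenvalues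
  besides \<open>0\<close> and \<open>r - lam\<close>; the corresponding eigenvalues of \<open>B\<close> are \<open>\<phi>\<close> and \<open>\<psi>\<close>.\<close>

definition \<phi> :: real where "\<phi> = (real y - real k) / (real x - real y)"
definition \<psi> :: real where "\<psi> = (real r - real lam + real y - real k) / (real x - real y)"

text \<open>The coefficient of the all-ones matrix in the product of \<open>M\<close> and \<open>B\<close>.\<close>

definition \<beta> :: real where "\<beta> = (real lam * real k - real y * real r) / (real x - real y)"

lemma card_points: "CARD('p) = v" and card_blocks: "CARD('b) = b"
  and card_block: "card (Q j) = k" and card_through_point: "card {j. p \<in> Q j} = r"
  and card_through_pair: "p \<noteq> q \<Longrightarrow> card {j. p \<in> Q j \<and> q \<in> Q j} = lam"
  and card_inter: "i \<noteq> j \<Longrightarrow> card (Q i \<inter> Q j) = x \<or> card (Q i \<inter> Q j) = y"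
  and x_neq_y: "x \<noteq> y"
  and ex_x: "\<exists>i j. i \<noteq> j \<and> card (Q i \<inter> Q j) = x"
  and ex_y: "\<exists>i j. i \<noteq> j \<and> card (Q i \<inter> Q j) = y"
  using qsd unfolding QSD_def design2_def quasi_symmetric_def by blast+

lemma incidence_nth [simp]: "M $ p $ j = (if p \<in> Q j then 1 else 0)"
  by (simp add: incidence_matrix_def)

lemma block_adjacency_nth [simp]: "B $ i $ j = (if block_graph x Q i j then 1 else 0)"
  by (simp add: adjacency_matrix_def)

lemma block_graph_sym: "block_graph x Q i j \<longleftrightarrow> block_graph x Q j i"
  by (auto simp: block_graph_def Int_commute)

lemma block_graph_irrefl [simp]: "\<not> block_graph x Q i i"
  by (simp add: block_graph_def)

lemma k_pos: "k > 0"
proof (rule ccontr)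
  assume "\<not> k > 0"
  then have "Q j = {}" for j using card_block[of j] by simp
  then show False using ex_x ex_y x_neq_y by auto
qed

lemma k_less_v: "k < v"
proof (rule ccontr)
  assume "\<not> k < v"
  then have "Q j = UNIV" for j
    using card_block[of j] card_points by (metis card_seteq finite leI subset_UNIV)
  then show False using ex_x ex_y x_neq_y by auto
qed

lemma b_pos: "b > 0"
  using card_blocks by auto

lemma sum_indicator: "(\<Sum>i\<in>(UNIV::'c::finite set). if P i then 1 else 0 :: complex) = of_nat (card {i. P i})"
  by (simp add: sum.If_cases)

lemma incidence_mult_transpose:
  "M ** transpose M = cscale (of_real (real r - real lam)) (mat 1) + cscale (of_nat lam) all_ones"
proof -
  have "(\<Sum>j\<in>UNIV. M $ p $ j * M $ q $ j) = of_nat (card {j. p \<in> Q j \<and> q \<in> Q j})" for p q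
    unfolding sum_indicator[symmetric] by (intro sum.cong) auto
  moreover have "card {j. p \<in> Q j \<and> q \<in> Q j} = (if p = q then r else lam)" for p q
    using card_through_pair card_through_point by auto
  ultimately show ?thesis by (simp add: vec_eq_iff matrix_matrix_mult_def)
qed

lemma transpose_mult_incidence:
  "transpose M ** M = cscale (of_real (real k - real y)) (mat 1)
     + cscale (of_real (real x - real y)) B + cscale (of_nat y) all_ones"
proof -
  have "(\<Sum>p\<in>UNIV. M $ p $ i * M $ p $ j) = of_nat (card (Q i \<inter> Q j))" for i j
  proof -
    have "(\<Sum>p\<in>UNIV. M $ p $ i * M $ p $ j) = (\<Sum>p\<in>UNIV. if p \<in> Q i \<and> p \<in> Q j then 1 else 0)"
      by (intro sum.cong) auto
    then show ?thesis by (simp add: sum_indicator Int_def)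
  qed
  moreover have "card (Q i \<inter> Q j) = (if i = j then k else if block_graph x Q i j then x else y)" for i j
    using card_inter[of i j] card_block[of i] by (auto simp: block_graph_def)
  ultimately show ?thesis by (auto simp: vec_eq_iff matrix_matrix_mult_def)
qed

lemma incidence_mult_ones: "M ** all_ones = cscale (of_nat r) all_ones"
  using card_through_point by (simp add: vec_eq_iff matrix_matrix_mult_def sum_indicator)

lemma ones_mult_incidence: "all_ones ** M = cscale (of_nat k) all_ones"
  using card_block by (simp add: vec_eq_iff matrix_matrix_mult_def sum_indicator)

lemma transpose_incidence_mult_ones: "transpose M ** all_ones = cscale (of_nat k) all_ones"
  using card_block by (simp add: vec_eq_iff matrix_matrix_mult_def sum_indicator)

lemma ones_mult_transpose_incidence: "all_ones ** transpose M = cscale (of_nat r) all_ones"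
  using card_through_point by (simp add: vec_eq_iff matrix_matrix_mult_def sum_indicator)

lemma vr_eq_bk: "v * r = b * k"
proof -
  have "(all_ones ** M) ** (all_ones :: complex^'b^'b) = (all_ones :: complex^'p^'b) ** (M ** all_ones)"
    by (rule matrix_mul_assoc[symmetric])
  then have "(of_nat (k * b) :: complex) = of_nat (r * v)"
    by (simp add: ones_mult_incidence incidence_mult_ones matrix_linear_simps
        all_ones_mult_all_ones card_points card_blocks vec_eq_iff)
  then show ?thesis unfolding of_nat_eq_iff by (simp add: mult.commute)
qed

lemma r_pos: "r > 0"
  using vr_eq_bk k_pos b_pos by (metis mult_eq_0_iff neq0_conv)

lemma rk_eq: "real r * real k = real r - real lam + real lam * real v"
proof -
  have "(M ** transpose M) ** (all_ones :: complex^'b^'p) = M ** (transpose M ** all_ones)"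
    by (rule matrix_mul_assoc[symmetric])
  then have "complex_of_real (real r * real k) = complex_of_real (real r - real lam + real lam * real v)"
    by (simp add: incidence_mult_transpose transpose_incidence_mult_ones incidence_mult_ones
        matrix_linear_simps all_ones_mult_all_ones card_points vec_eq_iff mult.commute)
  then show ?thesis unfolding of_real_eq_iff .
qed

lemma block_graph_regular:
  obtains d :: real where "B ** all_ones = cscale (of_real d) (all_ones :: complex^'b^'b)"
proof -
  define d where "d = (real r * real k - (real k - real y) - real y * real b) / (real x - real y)"
  have "(transpose M ** M) ** (all_ones :: complex^'b^'b) = transpose M ** (M ** all_ones)"
    by (rule matrix_mul_assoc[symmetric])
  then have "of_real (real k - real y) + of_real (real x - real y) * (B ** all_ones) $ i $ j
      + of_nat y * of_nat b = (of_nat r * of_nat k :: complex)" for i j :: 'b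
    by (simp add: transpose_mult_incidence transpose_incidence_mult_ones incidence_mult_ones
        matrix_linear_simps all_ones_mult_all_ones card_blocks vec_eq_iff)
  then have "(B ** all_ones) $ i $ j = of_real d" for i j :: 'b
    using x_neq_y unfolding d_def by (simp add: field_simps)
  then show ?thesis by (intro that[of d]) (simp add: vec_eq_iff)
qed

lemma transpose_block_adjacency: "transpose B = B"
proof -
  have "B $ j $ i = B $ i $ j" for i j
    unfolding block_adjacency_nth by (subst block_graph_sym) (rule refl)
  then show ?thesis by (simp del: block_adjacency_nth add: vec_eq_iff)
qed

text \<open>Both products of \<open>M\<close> with \<open>transpose M\<close> are known, so computing \<open>M ** transpose M ** M\<close> in two
  ways determines \<open>M ** B\<close>; likewise \<open>transpose M ** M ** B\<close> determines \<open>B ** B\<close> up to the coefficient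
  of the all-ones matrix, which the diagonal fixes once the degree of the block graph is known.\<close>

lemma incidence_mult_block_adjacency:
  "M ** B = cscale (of_real \<psi>) M + cscale (of_real \<beta>) all_ones"
proof -
  have "M ** (transpose M ** M) = (M ** transpose M) ** M"
    by (rule matrix_mul_assoc)
  then have "of_real (real k - real y) * M $ p $ j + of_real (real x - real y) * (M ** B) $ p $ j
      + of_nat y * of_nat r = of_real (real r - real lam) * M $ p $ j + of_nat lam * of_nat k" for p j
    unfolding transpose_mult_incidence incidence_mult_transpose
    by (simp del: incidence_nth add: matrix_linear_simps ones_mult_incidence incidence_mult_ones vec_eq_iff)
  then have "of_real (real x - real y) * (M ** B) $ p $ j
      = of_real (real r - real lam + real y - real k) * M $ p $ j
        + of_real (real lam * real k - real y * real r)" for p j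
    by (simp del: incidence_nth add: algebra_simps)
  moreover have "complex_of_real (real x - real y) \<noteq> 0" using x_neq_y by simp
  ultimately show ?thesis unfolding \<psi>_def \<beta>_def vec_eq_iff of_real_divide
    by (simp del: incidence_nth of_real_diff of_real_add of_real_mult add: field_simps)
qed

lemma block_adjacency_square_ex:
  obtains c where "B ** B = cscale (of_real (\<phi> + \<psi>)) B
    + cscale (of_real (- (\<phi> * \<psi>))) (mat 1) + cscale c all_ones"
proof -
  obtain d where d: "B ** all_ones = cscale (of_real d) (all_ones :: complex^'b^'b)"
    by (rule block_graph_regular)
  have d': "all_ones ** B = cscale (of_real d) (all_ones :: complex^'b^'b)"
  proof -
    have ones: "transpose (all_ones :: complex^'b^'b) = all_ones" by (simp add: vec_eq_iff)
    have "all_ones ** B = transpose (B ** (all_ones :: complex^'b^'b))"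
      by (simp only: matrix_transpose_mul transpose_block_adjacency ones)
    also have "\<dots> = cscale (of_real d) all_ones"
      by (simp only: d) (simp add: vec_eq_iff)
    finally show ?thesis .
  qed
  define s where "s = complex_of_real (real x - real y)"
  have s: "s \<noteq> 0" using x_neq_y by (simp add: s_def)
  define a where "a = - s * of_real \<phi>"
  define N where "N = transpose M ** M"
  have N: "N = cscale a (mat 1) + cscale s B + cscale (of_nat y) all_ones"
  proof -
    have "real k - real y = - ((real x - real y) * \<phi>)"
      using x_neq_y by (simp add: \<phi>_def)
    then have "of_real (real k - real y) = a"
      by (simp only: a_def s_def of_real_mult of_real_minus mult_minus_left)
    then show ?thesis by (simp only: N_def transpose_mult_incidence s_def)
  qed
  have "N ** B = transpose M ** (M ** B)"
    unfolding N_def by (rule matrix_mul_assoc[symmetric])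
  also have "\<dots> = cscale (of_real \<psi>) N + cscale (of_real \<beta> * of_nat k) all_ones"
    by (simp add: incidence_mult_block_adjacency matrix_linear_simps N_def transpose_incidence_mult_ones)
  finally have *: "a * B $ i $ j + s * (B ** B) $ i $ j + of_nat y * of_real d
     = of_real \<psi> * (a * mat 1 $ i $ j + s * B $ i $ j + of_nat y) + of_real \<beta> * of_nat k" for i j
    unfolding N by (simp del: block_adjacency_nth mat_one_nth add: matrix_linear_simps d' vec_eq_iff)
  define c where "c = (of_real \<psi> * of_nat y + of_real \<beta> * of_nat k - of_nat y * of_real d) / s"
  have solve: "w = of_real (\<phi> + \<psi>) * m + of_real (- (\<phi> * \<psi>)) * n + c"
    if "a * m + s * w + of_nat y * of_real d
     = of_real \<psi> * (a * n + s * m + of_nat y) + of_real \<beta> * of_nat k" for w m n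
  proof -
    have "s * c = of_real \<psi> * of_nat y + of_real \<beta> * of_nat k - of_nat y * of_real d"
      using s by (simp add: c_def)
    then have "s * w = s * (of_real (\<phi> + \<psi>) * m + of_real (- (\<phi> * \<psi>)) * n + c)"
      using that unfolding a_def of_real_add of_real_minus of_real_mult by algebra
    then show ?thesis using s by simp
  qed
  show ?thesis
    using solve[OF *] by (intro that[of c]) (simp del: block_adjacency_nth mat_one_nth add: vec_eq_iff)
qed

end

section \<open>The strongly regular block graph\<close>

lemma cscale_mult_vector: "cscale c A *v u = c *s (A *v u)"
  by (simp add: vec_eq_iff matrix_vector_mult_def sum_distrib_left mult_ac)

lemma all_ones_mult_vector: "(all_ones *v u) $ i = (\<Sum>j\<in>UNIV. u $ j)"
  by (simp add: matrix_vector_mult_def)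

lemmas matrix_vector_linear_simps =
  matrix_vector_mult_add_rdistrib cscale_mult_vector all_ones_mult_vector

text \<open>A connected regular graph with three distinct eigenvalues is strongly regular; for the block graph
  this is the lemma \<open>block_adjacency_square\<close> below.\<close>

locale strongly_regular_design = quasi_symmetric_design Q v k lam b r x y
  for Q :: "'b::finite \<Rightarrow> 'p::finite set" and v k lam b r x y +
  fixes e\<^sub>0 e\<^sub>1 e\<^sub>2 :: real
  assumes block_graph_G3: "block_graph x Q \<in> G3 e\<^sub>0 e\<^sub>1 e\<^sub>2"
begin

lemma e_order: "e\<^sub>1 < e\<^sub>0" "e\<^sub>2 < e\<^sub>1"
  and block_graph_connected: "connected_graph (block_graph x Q)"
  and eigenvalues_block_graph: "eigenvalues B = {of_real e\<^sub>0, of_real e\<^sub>1, of_real e\<^sub>2}"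
  using block_graph_G3 by (auto simp: G3_def)

text \<open>A graph with constant row sums \<open>d\<close> has the eigenvalue \<open>d\<close>, and looking at an entry of maximal
  modulus of an eigenvector shows that no eigenvalue has larger modulus.\<close>

lemma block_degree: "(\<Sum>j\<in>UNIV. B $ i $ j) = of_real e\<^sub>0"
proof -
  obtain d where d: "B ** all_ones = cscale (of_real d) (all_ones :: complex^'b^'b)"
    by (rule block_graph_regular)
  have row: "(\<Sum>j\<in>UNIV. B $ i $ j) = of_real d" for i
    using arg_cong[OF d, of "\<lambda>X. X $ i $ i"] by (simp add: matrix_matrix_mult_def)
  have "B *v 1 = of_real d *s 1"
    using row by (simp add: vec_eq_iff matrix_vector_mult_def)
  then have "complex_of_real d \<in> eigenvalues B"
    unfolding eigenvalues_def by (auto intro!: exI[of _ 1])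
  then have "d \<le> e\<^sub>0" using e_order by (auto simp: eigenvalues_block_graph)
  moreover have "e\<^sub>0 \<le> d"
  proof -
    have "complex_of_real e\<^sub>0 \<in> eigenvalues B" by (simp add: eigenvalues_block_graph)
    then obtain u where u: "u \<noteq> 0" "B *v u = of_real e\<^sub>0 *s u" by (auto simp: eigenvalues_def)
    define m where "m = Max (range (\<lambda>j. cmod (u $ j)))"
    have le: "cmod (u $ j) \<le> m" for j by (simp add: m_def)
    have "m \<in> range (\<lambda>j. cmod (u $ j))" unfolding m_def by (rule Max_in) auto
    then obtain i where i: "cmod (u $ i) = m" by auto
    obtain j where "u $ j \<noteq> 0" using u(1) by (auto simp: vec_eq_iff)
    then have "0 < m" using le[of j] by (meson less_le_trans zero_less_norm_iff)
    have "(\<Sum>j\<in>UNIV. cmod (B $ i $ j)) = Re (\<Sum>j\<in>UNIV. B $ i $ j)"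
      unfolding Re_sum by (intro sum.cong) auto
    then have norm_row: "(\<Sum>j\<in>UNIV. cmod (B $ i $ j)) = d" by (simp only: row Re_complex_of_real)
    have "of_real e\<^sub>0 * u $ i = (\<Sum>j\<in>UNIV. B $ i $ j * u $ j)"
      using arg_cong[OF u(2), of "\<lambda>w. w $ i"] by (simp add: matrix_vector_mult_def)
    then have "e\<^sub>0 * m \<le> cmod (\<Sum>j\<in>UNIV. B $ i $ j * u $ j)"
      using i \<open>0 < m\<close> by (metis abs_ge_self less_imp_le mult_right_mono norm_mult norm_of_real)
    also have "\<dots> \<le> (\<Sum>j\<in>UNIV. cmod (B $ i $ j) * m)"
      by (intro order_trans[OF norm_sum] sum_mono)
        (simp del: block_adjacency_nth add: norm_mult mult_left_mono le)
    also have "\<dots> = d * m" by (simp only: norm_row sum_distrib_right[symmetric])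
    finally show ?thesis using \<open>0 < m\<close> by simp
  qed
  ultimately have "d = e\<^sub>0" by simp
  then show ?thesis using row[of i] by (simp only:)
qed

lemma block_degree': "(\<Sum>i\<in>UNIV. B $ i $ j) = of_real e\<^sub>0"
proof -
  have "(\<Sum>i\<in>UNIV. B $ i $ j) = (\<Sum>i\<in>UNIV. transpose B $ j $ i)"
    by (simp only: transpose_nth)
  then show ?thesis by (simp only: transpose_block_adjacency block_degree)
qed

lemma ones_mult_block_adjacency: "all_ones ** B = cscale (of_real e\<^sub>0) all_ones"
  unfolding vec_eq_iff matrix_matrix_mult_def
  by (simp del: block_adjacency_nth add: block_degree')

lemma block_adjacency_mult_ones: "B ** all_ones = cscale (of_real e\<^sub>0) all_ones"
  unfolding vec_eq_iff matrix_matrix_mult_def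
  by (simp del: block_adjacency_nth add: block_degree)

lemma block_adjacency_square:
  "B ** B = cscale (of_real (\<phi> + \<psi>)) B + cscale (of_real (- (\<phi> * \<psi>))) (mat 1)
    + cscale (of_real (e\<^sub>0 + \<phi> * \<psi>)) all_ones"
proof -
  obtain c where c: "B ** B = cscale (of_real (\<phi> + \<psi>)) B
      + cscale (of_real (- (\<phi> * \<psi>))) (mat 1) + cscale c all_ones"
    by (rule block_adjacency_square_ex)
  fix i :: 'b
  have "B $ i $ j * B $ j $ i = B $ i $ j" for j
  proof -
    have "B $ j $ i = B $ i $ j"
      using arg_cong[OF transpose_block_adjacency, of "\<lambda>X. X $ i $ j"] by (simp only: transpose_nth)
    then show ?thesis by simp
  qed
  then have "(B ** B) $ i $ i = (\<Sum>j\<in>UNIV. B $ i $ j)"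
    unfolding matrix_matrix_mult_def by (simp only: vec_lambda_beta)
  then have "c = of_real (e\<^sub>0 + \<phi> * \<psi>)"
    using arg_cong[OF c, of "\<lambda>X. X $ i $ i"]
    by (simp del: block_adjacency_nth add: block_degree) (simp add: algebra_simps)
  then show ?thesis using c by simp
qed

text \<open>An eigenvector for an eigenvalue other than the degree has zero sum, so the quadratic relation
  for \<open>B\<close> loses its all-ones term on it.\<close>

lemma nonprincipal_eigenvalue:
  assumes "e = e\<^sub>1 \<or> e = e\<^sub>2"
  shows "e = \<phi> \<or> e = \<psi>"
proof -
  have "complex_of_real e \<in> eigenvalues B" using assms by (auto simp: eigenvalues_block_graph)
  then obtain u where u: "u \<noteq> 0" "B *v u = of_real e *s u" by (auto simp: eigenvalues_def)
  have "of_real e * (\<Sum>i\<in>UNIV. u $ i) = (\<Sum>i\<in>UNIV. (B *v u) $ i)"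
    by (simp add: u(2) sum_distrib_left)
  also have "\<dots> = (\<Sum>j\<in>UNIV. (\<Sum>i\<in>UNIV. B $ i $ j) * u $ j)"
    unfolding matrix_vector_mult_def sum_distrib_right by (simp del: block_adjacency_nth) (rule sum.swap)
  also have "\<dots> = of_real e\<^sub>0 * (\<Sum>i\<in>UNIV. u $ i)"
    by (simp only: block_degree' sum_distrib_left)
  finally have sum0: "(\<Sum>i\<in>UNIV. u $ i) = 0" using assms e_order by auto
  obtain i where i: "u $ i \<noteq> 0" using u(1) by (auto simp: vec_eq_iff)
  have "(B ** B) *v u = B *v (B *v u)" by (simp add: matrix_vector_mul_assoc)
  then have "((B ** B) *v u) $ i = of_real e * (of_real e * u $ i)"
    by (simp add: u(2) vector_scalar_commute)
  moreover have "((B ** B) *v u) $ i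
      = of_real (\<phi> + \<psi>) * (of_real e * u $ i) + of_real (- (\<phi> * \<psi>)) * u $ i"
    unfolding block_adjacency_square
    by (simp del: of_real_add of_real_minus of_real_mult add: matrix_vector_linear_simps u(2) sum0)
  ultimately have "of_real ((e - \<phi>) * (e - \<psi>)) * u $ i = 0"
    by (simp add: algebra_simps)
  then have "(e - \<phi>) * (e - \<psi>) = 0" using i by (simp only: mult_eq_0_iff of_real_eq_0_iff) auto
  then show ?thesis by auto
qed

lemma block_eigenvalues: "e\<^sub>1 + e\<^sub>2 = \<phi> + \<psi>" "e\<^sub>1 * e\<^sub>2 = \<phi> * \<psi>" "\<phi> < e\<^sub>0" "\<psi> < e\<^sub>0"
proof -
  have "e\<^sub>1 = \<phi> \<or> e\<^sub>1 = \<psi>" "e\<^sub>2 = \<phi> \<or> e\<^sub>2 = \<psi>" by (rule nonprincipal_eigenvalue; simp)+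
  then consider "\<phi> = e\<^sub>1" "\<psi> = e\<^sub>2" | "\<phi> = e\<^sub>2" "\<psi> = e\<^sub>1"
    using e_order(2) by fastforce
  then show "e\<^sub>1 + e\<^sub>2 = \<phi> + \<psi>" "e\<^sub>1 * e\<^sub>2 = \<phi> * \<psi>" "\<phi> < e\<^sub>0" "\<psi> < e\<^sub>0"
    using e_order by (cases; simp)+
qed

lemma b\<beta>_eq: "real b * \<beta> = real r * (e\<^sub>0 - \<psi>)"
proof -
  have "(M ** B) ** (all_ones :: complex^'b^'b) = M ** (B ** all_ones)"
    by (rule matrix_mul_assoc[symmetric])
  then have "complex_of_real (\<psi> * real r + \<beta> * real b) = of_real (e\<^sub>0 * real r)"
    by (simp add: incidence_mult_block_adjacency block_adjacency_mult_ones incidence_mult_ones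
        matrix_linear_simps all_ones_mult_all_ones card_blocks vec_eq_iff)
  then have "\<psi> * real r + \<beta> * real b = e\<^sub>0 * real r" unfolding of_real_eq_iff .
  then show ?thesis by (simp add: algebra_simps)
qed

lemma rk_eq_degree: "real r * real k = real k - real y + (real x - real y) * e\<^sub>0 + real y * real b"
proof -
  have "(transpose M ** M) ** (all_ones :: complex^'b^'b) = transpose M ** (M ** all_ones)"
    by (rule matrix_mul_assoc[symmetric])
  then have "complex_of_real (real r * real k)
      = of_real (real k - real y + (real x - real y) * e\<^sub>0 + real y * real b)"
    by (simp add: transpose_mult_incidence transpose_incidence_mult_ones incidence_mult_ones
        block_adjacency_mult_ones matrix_linear_simps all_ones_mult_all_ones card_blocks vec_eq_iff)
  then show ?thesis unfolding of_real_eq_iff .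
qed

lemma degree_square: "e\<^sub>0 * e\<^sub>0 = (\<phi> + \<psi>) * e\<^sub>0 - \<phi> * \<psi> + (e\<^sub>0 + \<phi> * \<psi>) * real b"
proof -
  have "(B ** B) ** (all_ones :: complex^'b^'b) = B ** (B ** all_ones)"
    by (rule matrix_mul_assoc[symmetric])
  then have "complex_of_real (e\<^sub>0 * e\<^sub>0) = of_real ((\<phi> + \<psi>) * e\<^sub>0 - \<phi> * \<psi> + (e\<^sub>0 + \<phi> * \<psi>) * real b)"
    unfolding block_adjacency_square
    by (simp del: cmat.scale_minus_left add: block_adjacency_mult_ones matrix_linear_simps
        all_ones_mult_all_ones card_blocks vec_eq_iff)
  then show ?thesis unfolding of_real_eq_iff .
qed

end

section \<open>Three eigenvalues\<close>

text \<open>The vector with the entries of \<open>u\<close> followed by those of \<open>w\<close>.\<close>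

definition block_vector :: "complex^'m \<Rightarrow> complex^'n \<Rightarrow> complex^('m + 'n)" where
  "block_vector u w = (\<chi> s. case s of Inl i \<Rightarrow> u $ i | Inr j \<Rightarrow> w $ j)"

lemma block_vector_nth [simp]:
  "block_vector u w $ Inl i = u $ i" "block_vector u w $ Inr j = w $ j"
  by (simp_all add: block_vector_def)

lemma block_vector_cases:
  obtains u w where "h = block_vector u w"
proof -
  have "h $ s = block_vector (\<chi> i. h $ Inl i) (\<chi> j. h $ Inr j) $ s" for s
    by (cases s) simp_all
  then have "h = block_vector (\<chi> i. h $ Inl i) (\<chi> j. h $ Inr j)"
    unfolding vec_eq_iff by (rule allI)
  then show ?thesis by (rule that)
qed

lemma block_vector_eq_iff: "block_vector u w = block_vector u' w' \<longleftrightarrow> u = u' \<and> w = w'"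
proof
  assume eq: "block_vector u w = block_vector u' w'"
  have "u $ i = u' $ i" for i using arg_cong[OF eq, of "\<lambda>h. h $ Inl i"] by simp
  moreover have "w $ j = w' $ j" for j using arg_cong[OF eq, of "\<lambda>h. h $ Inr j"] by simp
  ultimately show "u = u' \<and> w = w'" by (simp add: vec_eq_iff)
qed simp

lemma block_vector_zero: "block_vector 0 0 = 0"
proof -
  have "block_vector 0 0 $ s = 0" for s :: "'a + 'b" by (cases s) simp_all
  then show ?thesis by (simp add: vec_eq_iff)
qed

lemma block_matrix_mult_vector:
  "block_matrix A B C D *v block_vector u w = block_vector (A *v u + B *v w) (C *v u + D *v w)"
proof -
  have "(block_matrix A B C D *v block_vector u w) $ s
      = block_vector (A *v u + B *v w) (C *v u + D *v w) $ s" for s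
    by (cases s) (simp_all add: matrix_vector_mult_def sum_UNIV_sum)
  then show ?thesis by (simp add: vec_eq_iff)
qed

lemma scale_block_vector: "c *s block_vector u w = block_vector (c *s u) (c *s w)"
proof -
  have "(c *s block_vector u w) $ s = block_vector (c *s u) (c *s w) $ s" for s
    by (cases s) simp_all
  then show ?thesis by (simp add: vec_eq_iff)
qed

text \<open>The extension of the block graph by the points: distinct points are adjacent if \<open>\<kappa> = 1\<close>, which
  gives the whole graph, and non-adjacent if \<open>\<kappa> = 0\<close>, which gives the total graph.\<close>

locale block_extension = strongly_regular_design Q v k lam b r x y e\<^sub>0 e\<^sub>1 e\<^sub>2
  for Q :: "'b::finite \<Rightarrow> 'p::finite set" and v k lam b r x y e\<^sub>0 e\<^sub>1 e\<^sub>2 +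
  fixes \<kappa> \<theta>\<^sub>1 \<theta>\<^sub>2 :: real
  assumes kappa: "\<kappa> = 0 \<or> \<kappa> = 1"
    and theta1: "\<theta>\<^sub>1 \<ge> 1" and theta2: "\<theta>\<^sub>2 \<le> -2"
    and x_eq: "real x = real k + (\<theta>\<^sub>1 + 1) * (\<theta>\<^sub>2 + 1) - (e\<^sub>1 + 1) * (e\<^sub>2 + 1)"
    and y_eq: "real y = real k + \<theta>\<^sub>1 * \<theta>\<^sub>2 - e\<^sub>1 * e\<^sub>2"
    and lam_eq: "real lam = real r + (\<theta>\<^sub>1 + \<kappa>) * (\<theta>\<^sub>2 + \<kappa>)"
    and psi_eq: "\<psi> = \<theta>\<^sub>1 + \<theta>\<^sub>2 + \<kappa>"
    and beta_eq: "\<kappa> * real k + \<beta> =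
      sqrt ((\<kappa> * (real v - 1) + real r + \<theta>\<^sub>1 * \<theta>\<^sub>2) * (real k + e\<^sub>0 + \<theta>\<^sub>1 * \<theta>\<^sub>2))"
begin

text \<open>The adjacency matrix of the extension.\<close>

definition W :: "complex^('p + 'b)^('p + 'b)" where
  "W = block_matrix (cscale (of_real \<kappa>) (all_ones - mat 1)) M (transpose M) B"

text \<open>The degree of a point in the graph induced on the points.\<close>

definition \<delta> :: real where "\<delta> = \<kappa> * (real v - 1)"

lemma delta_nonneg: "\<delta> \<ge> 0"
  unfolding \<delta>_def using kappa k_less_v by auto

lemma yk_eq: "real y - real k = (real x - real y) * \<phi>"
  unfolding \<phi>_def using x_neq_y by simp

lemma xy_eq: "real x - real y = - \<kappa> - \<phi>"
  using x_eq y_eq block_eigenvalues(1) psi_eq by argo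

text \<open>The prescribed values of \<open>x\<close> and \<open>y\<close> turn the definition of \<open>\<phi>\<close> into a quadratic equation
  for \<open>\<phi>\<close> with the roots \<open>\<theta>\<^sub>1\<close> and \<open>\<theta>\<^sub>2\<close>.\<close>

lemma phi_theta: "\<phi> = \<theta>\<^sub>1 \<or> \<phi> = \<theta>\<^sub>2"
proof -
  have "(- \<kappa> - \<phi>) * \<phi> = \<theta>\<^sub>1 * \<theta>\<^sub>2 - \<phi> * \<psi>"
    using yk_eq xy_eq y_eq block_eigenvalues(2) by simp
  then have "(\<phi> - \<theta>\<^sub>1) * (\<phi> - \<theta>\<^sub>2) = 0" unfolding psi_eq by (simp add: algebra_simps)
  then show ?thesis by auto
qed

text \<open>The matrix with rows \<open>(\<delta>, r)\<close> and \<open>(k, e\<^sub>0)\<close> describes the action of \<open>W\<close> on the vectors that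
  are constant on the points and on the blocks. One of its eigenvalues is \<open>\<theta>\<^sub>1\<close> or \<open>\<theta>\<^sub>2\<close>; the other one
  is larger than \<open>\<theta>\<^sub>1\<close>. Evaluating the polynomial \<open>(t - \<theta>\<^sub>1) (t - \<theta>\<^sub>2)\<close> at this matrix gives the matrix with rows
  \<open>(v \<alpha>, b \<mu>)\<close> and \<open>(v \<mu>, b \<gamma>)\<close>, where \<open>\<alpha> = \<delta> + r + \<theta>\<^sub>1 \<theta>\<^sub>2\<close>, \<open>\<gamma> = k + e\<^sub>0 + \<theta>\<^sub>1 \<theta>\<^sub>2\<close> and
  \<open>\<mu> = \<kappa> k + \<beta>\<close>. The hypothesis on \<open>\<beta>\<close> says that \<open>\<mu>\<close> is the square root of \<open>\<alpha> \<gamma>\<close>: the determinant vanishes. Since \<open>\<mu>\<close> is positive, \<open>\<alpha>\<close> and \<open>\<gamma>\<close>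
  have the same sign; if they are positive, then so is the trace
  \<open>(\<rho> - \<theta>\<^sub>1) (\<rho> - \<theta>\<^sub>2)\<close>.\<close>

lemma quotient_eigenvalues:
  obtains \<rho> t where "t = \<theta>\<^sub>1 \<or> t = \<theta>\<^sub>2" "\<rho> > \<theta>\<^sub>1" "\<rho> + t = \<delta> + e\<^sub>0" "\<rho> * t = \<delta> * e\<^sub>0 - real r * real k"
proof -
  define \<alpha> where "\<alpha> = \<delta> + real r + \<theta>\<^sub>1 * \<theta>\<^sub>2"
  define \<gamma> where "\<gamma> = real k + e\<^sub>0 + \<theta>\<^sub>1 * \<theta>\<^sub>2"
  define \<mu> where "\<mu> = \<kappa> * real k + \<beta>"
  define \<tau> where "\<tau> = \<theta>\<^sub>1 + \<theta>\<^sub>2"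
  define p where "p = (\<lambda>t. (t - \<delta>) * (t - e\<^sub>0) - real r * real k)"
  have pos: "real k \<ge> 1" "real r > 0" "real b > 0" "real v > 0"
    using k_pos r_pos b_pos k_less_v by simp_all
  have vr: "real v * real r = real b * real k"
    using vr_eq_bk by (metis of_nat_mult)
  have v\<alpha>: "real v * \<alpha> = \<delta> * \<delta> + real r * real k - \<tau> * \<delta> + \<theta>\<^sub>1 * \<theta>\<^sub>2"
    using kappa unfolding rk_eq lam_eq \<alpha>_def \<delta>_def \<tau>_def by (auto simp: algebra_simps)
  have b\<mu>: "real b * \<mu> = real r * (\<delta> + e\<^sub>0 - \<tau>)"
    using b\<beta>_eq vr unfolding \<mu>_def \<delta>_def \<tau>_def psi_eq by (simp add: algebra_simps)
  have v\<mu>: "real v * \<mu> = real k * (\<delta> + e\<^sub>0 - \<tau>)"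
  proof -
    have "real b * (real v * \<mu>) = real b * (real k * (\<delta> + e\<^sub>0 - \<tau>))"
      using b\<mu> vr by algebra
    then show ?thesis using pos by simp
  qed
  have b\<gamma>: "real b * \<gamma> = real r * real k + e\<^sub>0 * e\<^sub>0 - \<tau> * e\<^sub>0 + \<theta>\<^sub>1 * \<theta>\<^sub>2"
  proof -
    have "real y = real k + \<theta>\<^sub>1 * \<theta>\<^sub>2 - \<phi> * \<psi>"
      using y_eq block_eigenvalues(2) by simp
    then show ?thesis using rk_eq_degree degree_square xy_eq psi_eq unfolding \<gamma>_def \<tau>_def by algebra
  qed
  have e0: "e\<^sub>0 > \<tau> + \<kappa>" using block_eigenvalues(4) psi_eq by (simp add: \<tau>_def)
  have kap: "\<kappa> \<ge> 0" using kappa by auto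
  have "real b * \<mu> > 0" unfolding b\<mu> using e0 delta_nonneg kap pos by simp
  then have \<mu>_pos: "\<mu> > 0" using pos by (simp add: zero_less_mult_iff)
  have \<mu>_sqrt: "\<mu> = sqrt (\<alpha> * \<gamma>)" using beta_eq by (simp add: \<mu>_def \<alpha>_def \<gamma>_def \<delta>_def)
  then have \<alpha>\<gamma>: "\<alpha> * \<gamma> > 0" using \<mu>_pos by simp
  then have \<mu>2: "\<mu> * \<mu> = \<alpha> * \<gamma>" by (simp add: \<mu>_sqrt)
  have "p \<theta>\<^sub>1 * p \<theta>\<^sub>2 = (real v * \<alpha>) * (real b * \<gamma>) - (real b * \<mu>) * (real v * \<mu>)"
    unfolding v\<alpha> b\<mu> v\<mu> b\<gamma> p_def \<tau>_def by algebra
  also have "\<dots> = 0" using \<mu>2 by algebra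
  finally obtain t where t: "t = \<theta>\<^sub>1 \<or> t = \<theta>\<^sub>2" "p t = 0" by auto
  define \<rho> where "\<rho> = \<delta> + e\<^sub>0 - t"
  have sum: "\<rho> + t = \<delta> + e\<^sub>0" by (simp add: \<rho>_def)
  have prod: "\<rho> * t = \<delta> * e\<^sub>0 - real r * real k"
    using t(2) unfolding \<rho>_def p_def by algebra
  have "(t - \<theta>\<^sub>1) * (t - \<theta>\<^sub>2) = 0" using t(1) by auto
  then have trace: "real v * \<alpha> + real b * \<gamma> = (\<rho> - \<theta>\<^sub>1) * (\<rho> - \<theta>\<^sub>2)"
    using sum prod unfolding v\<alpha> b\<gamma> \<tau>_def by algebra
  have \<rho>_gt: "\<rho> > \<theta>\<^sub>2" "t = \<theta>\<^sub>2 \<Longrightarrow> \<rho> > \<theta>\<^sub>1"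
    using t(1) e0 kap delta_nonneg theta1 theta2 by (auto simp: \<rho>_def \<tau>_def)
  have "\<rho> > \<theta>\<^sub>1"
  proof (cases "\<alpha> > 0")
    case True
    then have "\<gamma> > 0" using \<alpha>\<gamma> by (simp add: zero_less_mult_iff)
    then have "(\<rho> - \<theta>\<^sub>1) * (\<rho> - \<theta>\<^sub>2) > 0" using True pos unfolding trace[symmetric] by (simp add: add_pos_pos)
    then show ?thesis using \<rho>_gt by (simp add: zero_less_mult_iff)
  next
    case False
    \<comment> \<open>Then \<open>\<theta>\<^sub>1\<close> is the larger eigenvalue of the quotient matrix. The bounds below on \<open>\<theta>\<^sub>1 - \<delta>\<close> and
      \<open>\<theta>\<^sub>1 - e\<^sub>0\<close> make their product too small.\<close>
    then have "\<alpha> < 0" "\<gamma> < 0" using \<alpha>\<gamma> by (auto simp: zero_less_mult_iff)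
    then have "(\<rho> - \<theta>\<^sub>1) * (\<rho> - \<theta>\<^sub>2) < 0"
      using pos unfolding trace[symmetric] by (simp add: add_neg_neg mult_pos_neg)
    then have \<rho>_less: "\<rho> < \<theta>\<^sub>1" using \<rho>_gt by (simp add: mult_less_0_iff)
    then have t1: "t = \<theta>\<^sub>1" using t(1) \<rho>_gt by auto
    have "(\<theta>\<^sub>1 - \<delta>) * (\<theta>\<^sub>1 - e\<^sub>0) = real r * real k" using t(2) t1 by (simp add: p_def)
    then have prod_eq: "(\<theta>\<^sub>1 - \<delta>) * (\<theta>\<^sub>1 - e\<^sub>0) = real r * real k" "(\<theta>\<^sub>1 - \<delta>) * (\<theta>\<^sub>1 - e\<^sub>0) > 0"
      using pos by simp_all
    have "\<theta>\<^sub>1 > \<delta> \<and> \<theta>\<^sub>1 > e\<^sub>0"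
      using prod_eq(2) \<rho>_less sum t1 unfolding zero_less_mult_iff by linarith
    then have less: "\<theta>\<^sub>1 > \<delta>" "\<theta>\<^sub>1 > e\<^sub>0" by simp_all
    define a where "a = - \<theta>\<^sub>2 - \<kappa>"
    have "a > 0" using theta2 kappa by (auto simp: a_def)
    have "(\<theta>\<^sub>1 + \<kappa>) * a = real r - real lam" using lam_eq by (simp add: a_def algebra_simps)
    then have "(\<theta>\<^sub>1 - \<delta>) * a \<le> real r"
      using \<open>a > 0\<close> kap delta_nonneg mult_right_mono[of "\<theta>\<^sub>1 - \<delta>" "\<theta>\<^sub>1 + \<kappa>" a] by simp
    moreover have "(\<theta>\<^sub>1 - \<delta>) * (\<theta>\<^sub>1 - e\<^sub>0) < (\<theta>\<^sub>1 - \<delta>) * a"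
      using less e0 by (intro mult_strict_left_mono) (simp_all add: a_def \<tau>_def)
    moreover have "real r \<le> real r * real k" using pos by simp
    ultimately show ?thesis using prod_eq by linarith
  qed
  then show ?thesis using that[OF t(1) _ sum prod] by blast
qed

text \<open>The larger eigenvalue of the quotient matrix.\<close>

definition \<theta>\<^sub>0 :: real where "\<theta>\<^sub>0 = (\<delta> + e\<^sub>0 + sqrt ((\<delta> - e\<^sub>0)\<^sup>2 + 4 * real r * real k)) / 2"

lemma theta0:
  obtains t where "t = \<theta>\<^sub>1 \<or> t = \<theta>\<^sub>2" "\<theta>\<^sub>0 > \<theta>\<^sub>1" "\<theta>\<^sub>0 + t = \<delta> + e\<^sub>0" "\<theta>\<^sub>0 * t = \<delta> * e\<^sub>0 - real r * real k"
proof -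
  obtain \<rho> t where *: "t = \<theta>\<^sub>1 \<or> t = \<theta>\<^sub>2" "\<rho> > \<theta>\<^sub>1" "\<rho> + t = \<delta> + e\<^sub>0" "\<rho> * t = \<delta> * e\<^sub>0 - real r * real k"
    by (rule quotient_eigenvalues)
  have "(\<delta> - e\<^sub>0)\<^sup>2 + 4 * real r * real k = (\<rho> - t)\<^sup>2" using *(3,4) by algebra
  moreover have "\<rho> > t" using * theta1 theta2 by auto
  ultimately have "\<theta>\<^sub>0 = \<rho>" using *(3) by (simp add: \<theta>\<^sub>0_def)
  then show ?thesis using * by (intro that[of t]) simp_all
qed

lemma theta0_is_root: "(\<theta>\<^sub>0 - \<delta>) * (\<theta>\<^sub>0 - e\<^sub>0) = real r * real k"
  and theta0_gt: "\<theta>\<^sub>0 > \<theta>\<^sub>1"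
proof -
  obtain t where *: "\<theta>\<^sub>0 > \<theta>\<^sub>1" "\<theta>\<^sub>0 + t = \<delta> + e\<^sub>0" "\<theta>\<^sub>0 * t = \<delta> * e\<^sub>0 - real r * real k"
    by (rule theta0)
  show "\<theta>\<^sub>0 > \<theta>\<^sub>1" "(\<theta>\<^sub>0 - \<delta>) * (\<theta>\<^sub>0 - e\<^sub>0) = real r * real k" using * by (simp, algebra)
qed

text \<open>For \<open>\<kappa> = 0\<close> the quotient matrix has the negative determinant \<open>- r k\<close>, so its other eigenvalue
  is the negative one of \<open>\<theta>\<^sub>1\<close> and \<open>\<theta>\<^sub>2\<close>.\<close>

lemma theta0_total:
  assumes "\<kappa> = 0"
  shows "\<theta>\<^sub>0 = e\<^sub>0 - \<theta>\<^sub>2"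
proof -
  obtain t where *: "t = \<theta>\<^sub>1 \<or> t = \<theta>\<^sub>2" "\<theta>\<^sub>0 > \<theta>\<^sub>1" "\<theta>\<^sub>0 + t = \<delta> + e\<^sub>0" "\<theta>\<^sub>0 * t = \<delta> * e\<^sub>0 - real r * real k"
    by (rule theta0)
  have "\<delta> = 0" unfolding \<delta>_def using assms by simp
  then have "\<theta>\<^sub>0 * t < 0" using * r_pos k_pos by simp
  then have "t < 0" using *(2) theta1 by (simp add: mult_less_0_iff)
  then show ?thesis using * theta1 \<open>\<delta> = 0\<close> by auto
qed

lemma W_mult_vector:
  "W *v block_vector u w = block_vector
     (\<chi> p. of_real \<kappa> * ((\<Sum>q\<in>UNIV. u $ q) - u $ p) + (M *v w) $ p) (transpose M *v u + B *v w)"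
  unfolding W_def block_matrix_mult_vector block_vector_eq_iff
  by (simp add: vec_eq_iff matrix_vector_linear_simps matrix_vector_mult_diff_rdistrib right_diff_distrib)

lemma incidence_mult_one: "M *v (c *s 1) = (c * of_nat r) *s 1"
proof -
  have "(M *v (c *s 1)) $ p = (M ** (all_ones :: complex^'b^'b)) $ p $ j * c" for p j
    by (simp del: incidence_nth add: matrix_vector_mult_def matrix_matrix_mult_def sum_distrib_right)
  then show ?thesis unfolding incidence_mult_ones by (simp add: vec_eq_iff mult.commute)
qed

lemma transpose_incidence_mult_one: "transpose M *v (c *s 1) = (c * of_nat k) *s 1"
proof -
  have "(transpose M *v (c *s 1)) $ i = (transpose M ** (all_ones :: complex^'b^'p)) $ i $ j * c" for i j
    unfolding matrix_vector_mult_def matrix_matrix_mult_def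
    by (simp del: incidence_nth add: sum_distrib_right)
  then show ?thesis unfolding transpose_incidence_mult_ones
    by (simp del: transpose_matrix_vector add: vec_eq_iff mult.commute)
qed

lemma block_adjacency_mult_one: "B *v (c *s 1) = (c * of_real e\<^sub>0) *s 1"
proof -
  have "(B *v (c *s 1)) $ i = (\<Sum>j\<in>UNIV. B $ i $ j) * c" for i
    by (simp del: block_adjacency_nth add: matrix_vector_mult_def sum_distrib_right)
  then show ?thesis by (simp only: block_degree) (simp add: vec_eq_iff mult.commute)
qed

lemma eigenvalue_quotient:
  assumes "(c - of_real \<delta>) * (c - of_real e\<^sub>0) = of_nat r * of_nat k"
  shows "c \<in> eigenvalues W"
proof -
  let ?h = "block_vector (of_nat r *s 1) ((c - of_real \<delta>) *s 1) :: complex^('p + 'b)"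
  have "W *v ?h = c *s ?h"
    unfolding W_mult_vector scale_block_vector block_vector_eq_iff incidence_mult_one
      transpose_incidence_mult_one block_adjacency_mult_one
    using assms card_points by (simp add: vec_eq_iff \<delta>_def algebra_simps)
  moreover have "?h $ Inl p \<noteq> 0" for p using r_pos by simp
  then have "?h \<noteq> 0" by (metis zero_index)
  ultimately show ?thesis by (auto simp: eigenvalues_def)
qed

text \<open>A vector \<open>z\<close> on the points with zero sum extends to an eigenvector by a multiple of
  \<open>transpose M *v z\<close> on the blocks.\<close>

lemma eigenvalue_zero_sum:
  assumes "(\<eta> = \<theta>\<^sub>1 \<and> \<eta>' = \<theta>\<^sub>2) \<or> (\<eta> = \<theta>\<^sub>2 \<and> \<eta>' = \<theta>\<^sub>1)"
  shows "complex_of_real \<eta> \<in> eigenvalues W"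
proof -
  have nz: "\<eta>' + \<kappa> \<noteq> 0" using assms theta1 theta2 kappa by auto
  \<comment> \<open>The point entries require \<open>c (r - lam) - \<kappa> = \<eta>\<close>, where \<open>r - lam = - (\<eta> + \<kappa>) (\<eta>' + \<kappa>)\<close>.\<close>
  define c where "c = - 1 / (\<eta>' + \<kappa>)"
  have c: "c * (\<eta>' + \<kappa>) = - 1" using nz by (simp add: c_def)
  have sum: "\<eta> + \<eta>' = \<theta>\<^sub>1 + \<theta>\<^sub>2" "real r - real lam = - (\<eta> + \<kappa>) * (\<eta>' + \<kappa>)"
    using assms lam_eq by (auto simp: algebra_simps)
  have c1: "c * (real r - real lam) - \<kappa> = \<eta>" using c sum by algebra
  have c2: "1 + c * \<psi> = \<eta> * c" using c sum psi_eq by algebra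
  obtain p q :: 'p where pq: "p \<noteq> q"
  proof -
    fix j
    have "Q j \<noteq> {}" using card_block[of j] k_pos by auto
    moreover have "Q j \<noteq> UNIV" using card_block[of j] k_less_v card_points by auto
    ultimately obtain p q where "p \<in> Q j" "q \<notin> Q j" by blast
    then show ?thesis by (intro that[of p q]) auto
  qed
  define z :: "complex^'p" where "z = axis p 1 - axis q 1"
  have z0: "(\<Sum>i\<in>UNIV. z $ i) = 0" by (simp add: z_def axis_def sum_subtractf)
  define w where "w = transpose M *v z"
  have Mw: "M *v w = of_real (real r - real lam) *s z"
    unfolding w_def matrix_vector_mul_assoc incidence_mult_transpose
    by (simp del: of_real_diff add: vec_eq_iff matrix_vector_linear_simps z0)
  have "B ** transpose M = transpose (M ** B)"
    by (simp only: matrix_transpose_mul transpose_block_adjacency)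
  also have "\<dots> = cscale (of_real \<psi>) (transpose M) + cscale (of_real \<beta>) all_ones"
    by (simp add: incidence_mult_block_adjacency vec_eq_iff)
  finally have BM: "B ** transpose M = cscale (of_real \<psi>) (transpose M) + cscale (of_real \<beta>) all_ones" .
  have Bw: "B *v w = of_real \<psi> *s w"
    unfolding w_def matrix_vector_mul_assoc BM
    by (simp add: vec_eq_iff matrix_vector_linear_simps z0)
  let ?h = "block_vector z (of_real c *s w)"
  have "W *v ?h = of_real \<eta> *s ?h"
    unfolding W_mult_vector scale_block_vector block_vector_eq_iff z0 vector_scalar_commute Mw Bw
  proof
    have "of_real (c * (real r - real lam) - \<kappa>) * z $ i = of_real \<eta> * z $ i" for i
      by (simp only: c1)
    then show "(\<chi> i. of_real \<kappa> * (0 - z $ i)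
        + (of_real c *s (of_real (real r - real lam) *s z)) $ i) = of_real \<eta> *s z"
      by (simp add: vec_eq_iff algebra_simps)
    have "of_real (1 + c * \<psi>) * w $ j = of_real (\<eta> * c) * w $ j" for j
      by (simp only: c2)
    then show "transpose M *v z + of_real c *s (of_real \<psi> *s w) = of_real \<eta> *s (of_real c *s w)"
      unfolding w_def[symmetric] by (simp add: vec_eq_iff algebra_simps)
  qed
  moreover have "?h $ Inl p \<noteq> 0" using pq by (simp add: z_def axis_def)
  then have "?h \<noteq> 0" by (metis zero_index)
  ultimately show ?thesis by (auto simp: eigenvalues_def)
qed

text \<open>Conversely, an eigenvector for any value other than \<open>\<theta>\<^sub>1\<close> and \<open>\<theta>\<^sub>2\<close> is constant on the points and
  on the blocks, so its eigenvalue is one of the quotient matrix.\<close>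

lemma eigenvalue_cases:
  assumes "c \<in> eigenvalues W"
  shows "c = of_real \<theta>\<^sub>0 \<or> c = of_real \<theta>\<^sub>1 \<or> c = of_real \<theta>\<^sub>2"
proof (rule ccontr)
  assume "\<not> ?thesis"
  then have c: "c \<noteq> of_real \<theta>\<^sub>0" "c \<noteq> of_real \<theta>\<^sub>1" "c \<noteq> of_real \<theta>\<^sub>2" by auto
  obtain h where h: "h \<noteq> 0" "W *v h = c *s h" using assms by (auto simp: eigenvalues_def)
  obtain u w where uw: "h = block_vector u w" by (rule block_vector_cases)
  define U where "U = (\<Sum>q\<in>UNIV. u $ q)"
  define V where "V = (\<Sum>j\<in>UNIV. w $ j)"
  have 1: "of_real \<kappa> * (U - u $ p) + (M *v w) $ p = c * u $ p" for p
    using h(2) unfolding uw W_mult_vector scale_block_vector block_vector_eq_iff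
    by (simp add: vec_eq_iff U_def)
  have 2: "transpose M *v u + B *v w = c *s w"
    using h(2) unfolding uw W_mult_vector scale_block_vector block_vector_eq_iff
    by simp
  have Mw: "(M *v w) $ p = (c + of_real \<kappa>) * u $ p - of_real \<kappa> * U" for p
    using 1[of p] by (simp add: algebra_simps)
  \<comment> \<open>Eliminating the block part shows that the point part is constant.\<close>
  have "(M ** transpose M) *v u + (M ** B) *v w = c *s (M *v w)"
    using arg_cong[OF 2, of "\<lambda>w. M *v w"]
    by (simp only: matrix_vector_right_distrib matrix_vector_mul_assoc vector_scalar_commute)
  then have 3: "of_real (real r - real lam) * u $ p + of_nat lam * U + (of_real \<psi> * (M *v w) $ p + of_real \<beta> * V)
      = c * (M *v w) $ p" for p
    unfolding incidence_mult_transpose incidence_mult_block_adjacency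
    by (simp del: of_real_diff add: vec_eq_iff matrix_vector_linear_simps U_def V_def)
  define \<epsilon> where "\<epsilon> = (c - of_real \<theta>\<^sub>1) * (c - of_real \<theta>\<^sub>2)"
  have \<epsilon>: "\<epsilon> \<noteq> 0" using c by (simp add: \<epsilon>_def)
  have "complex_of_real (real r - real lam) = - (of_real \<theta>\<^sub>1 + of_real \<kappa>) * (of_real \<theta>\<^sub>2 + of_real \<kappa>)"
    unfolding lam_eq by (simp add: algebra_simps)
  moreover have "complex_of_real \<psi> = of_real \<theta>\<^sub>1 + of_real \<theta>\<^sub>2 + of_real \<kappa>"
    unfolding psi_eq by simp
  ultimately have "\<epsilon> * u $ p = of_nat lam * U + of_real \<beta> * V + (c - of_real \<psi>) * of_real \<kappa> * U" for p
    using 3[of p] unfolding Mw \<epsilon>_def by algebra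
  then have "u $ p = (of_nat lam * U + of_real \<beta> * V + (c - of_real \<psi>) * of_real \<kappa> * U) / \<epsilon>" for p
    using \<epsilon> by (simp add: field_simps)
  then obtain a where a: "u = a *s 1" by (auto simp: vec_eq_iff)
  \<comment> \<open>Hence so is the block part.\<close>
  obtain m where m: "M *v w = m *s 1"
    using Mw by (auto simp: vec_eq_iff a)
  have Bw: "B *v w = c *s w - (a * of_nat k) *s 1"
    using 2 unfolding a transpose_incidence_mult_one by (simp add: algebra_simps)
  have "(transpose M ** M) *v w = (m * of_nat k) *s 1"
    by (simp only: m transpose_incidence_mult_one matrix_vector_mul_assoc[symmetric])
  then have 4: "of_real (real k - real y) * w $ j + of_real (real x - real y) * (c * w $ j - a * of_nat k) + of_nat y * V
      = m * of_nat k" for j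
    unfolding transpose_mult_incidence
    by (simp del: of_real_diff add: vec_eq_iff matrix_vector_linear_simps V_def Bw right_diff_distrib mult.assoc)
  define s where "s = complex_of_real (real x - real y)"
  have s: "s \<noteq> 0" using x_neq_y by (simp add: s_def)
  have "c \<noteq> of_real \<phi>" using c phi_theta by auto
  have "real k - real y = - ((real x - real y) * \<phi>)" using yk_eq by simp
  then have ky: "complex_of_real (real k - real y) = - (s * of_real \<phi>)"
    by (simp only: s_def of_real_mult of_real_minus)
  have "s * (c - of_real \<phi>) * w $ j = m * of_nat k - of_nat y * V + s * a * of_nat k" for j
    using 4[of j] unfolding ky s_def[symmetric] by algebra
  then have "w $ j = (m * of_nat k - of_nat y * V + s * a * of_nat k) / (s * (c - of_real \<phi>))" for j
    using s \<open>c \<noteq> of_real \<phi>\<close> by (simp add: field_simps)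
  then obtain d where d: "w = d *s 1" by (auto simp: vec_eq_iff)
  have "U = of_nat v * a" by (simp add: U_def a card_points)
  then have q1: "of_real \<delta> * a + d * of_nat r = c * a"
    using 1 unfolding d incidence_mult_one by (simp add: a \<delta>_def algebra_simps)
  have q2: "a * of_nat k + d * of_real e\<^sub>0 = c * d"
    using 2 unfolding a d transpose_incidence_mult_one block_adjacency_mult_one by (simp add: vec_eq_iff)
  have "d \<noteq> 0"
  proof
    assume "d = 0"
    then have "a = 0" using q2 k_pos by simp
    then show False using h(1) \<open>d = 0\<close> by (simp add: uw a d block_vector_zero)
  qed
  have "(c - of_real \<delta>) * (c - of_real e\<^sub>0) * d = of_nat r * of_nat k * d"
    using q1 q2 by algebra
  then have root: "(c - of_real \<delta>) * (c - of_real e\<^sub>0) = of_nat r * of_nat k"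
    using \<open>d \<noteq> 0\<close> by simp
  obtain t where t: "t = \<theta>\<^sub>1 \<or> t = \<theta>\<^sub>2" "\<theta>\<^sub>0 + t = \<delta> + e\<^sub>0" "\<theta>\<^sub>0 * t = \<delta> * e\<^sub>0 - real r * real k"
    by (rule theta0)
  have "complex_of_real \<theta>\<^sub>0 + of_real t = of_real \<delta> + of_real e\<^sub>0"
    using arg_cong[OF t(2), of complex_of_real] by simp
  moreover have "complex_of_real \<theta>\<^sub>0 * of_real t = of_real \<delta> * of_real e\<^sub>0 - of_nat r * of_nat k"
    using arg_cong[OF t(3), of complex_of_real] by simp
  ultimately have "(c - of_real \<theta>\<^sub>0) * (c - of_real t) = 0" using root by algebra
  then show False using c t(1) by auto
qed

lemma eigenvalues_W: "eigenvalues W = {of_real \<theta>\<^sub>0, of_real \<theta>\<^sub>1, of_real \<theta>\<^sub>2}"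
proof -
  have "(complex_of_real \<theta>\<^sub>0 - of_real \<delta>) * (of_real \<theta>\<^sub>0 - of_real e\<^sub>0) = of_nat r * of_nat k"
    using arg_cong[OF theta0_is_root, of complex_of_real] by simp
  then have "complex_of_real \<theta>\<^sub>0 \<in> eigenvalues W" by (rule eigenvalue_quotient)
  then show ?thesis using eigenvalue_cases eigenvalue_zero_sum by blast
qed

lemma W_graph_in_G3:
  assumes E: "adjacency_matrix E = W"
  shows "E \<in> G3 \<theta>\<^sub>0 \<theta>\<^sub>1 \<theta>\<^sub>2"
proof -
  have E_iff: "E s t \<longleftrightarrow> W $ s $ t = 1" for s t
    by (simp add: adjacency_matrix_def flip: E)
  have sym: "W $ s $ t = W $ t $ s" for s t
    by (cases s; cases t) (auto simp: W_def block_graph_sym)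
  have "W $ s $ s = 0" for s
    by (cases s) (simp_all add: W_def)
  then have "simple_graph E"
    unfolding simple_graph_def by (auto simp: E_iff sym intro!: sympI irreflpI)
  moreover have "connected_graph E"
  proof -
    have bb: "E\<^sup>*\<^sup>* (Inr i) (Inr j)" for i j
    proof -
      have "(block_graph x Q)\<^sup>*\<^sup>* i j" using block_graph_connected by (simp add: connected_graph_def)
      then show ?thesis
      proof induction
        case (step j l)
        then have "E (Inr j) (Inr l)" by (simp add: E_iff W_def)
        then show ?case using step by (meson rtranclp.rtrancl_into_rtrancl)
      qed simp
    qed
    have "\<exists>j. E\<^sup>*\<^sup>* s (Inr j) \<and> E\<^sup>*\<^sup>* (Inr j) s" for s
    proof (cases s)
      case (Inl p)
      have "{j. p \<in> Q j} \<noteq> {}" using card_through_point[of p] r_pos by force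
      then obtain j where "p \<in> Q j" by auto
      then have "E s (Inr j)" "E (Inr j) s" by (simp_all add: E_iff W_def Inl)
      then show ?thesis by blast
    qed auto
    then show ?thesis unfolding connected_graph_def using bb by (meson rtranclp_trans)
  qed
  ultimately show ?thesis
    using theta0_gt theta1 theta2 eigenvalues_W by (simp add: G3_def E)
qed

end

section \<open>The coherent closure\<close>

lemma span_pair: "X \<in> cmat.span {C, D} \<longleftrightarrow> (\<exists>c d. X = cscale c C + cscale d D)"
  by (auto simp: cmat.span_insert cmat.span_singleton algebra_simps)

lemma span_triple:
  "X \<in> cmat.span {C, D, E} \<longleftrightarrow> (\<exists>c d e. X = cscale c C + cscale d D + cscale e E)"
proof -
  have "X \<in> cmat.span {C, D, E} \<longleftrightarrow> (\<exists>c. X - cscale c C \<in> cmat.span {D, E})"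
    by (rule cmat.span_breakdown_eq)
  then show ?thesis unfolding span_pair by (simp add: algebra_simps)
qed

lemma matrix_mult_in_span:
  assumes "X \<in> cmat.span S" and "Y \<in> cmat.span T"
    and prod: "\<And>C D. C \<in> S \<Longrightarrow> D \<in> T \<Longrightarrow> C ** D \<in> cmat.span U"
  shows "X ** Y \<in> cmat.span U"
  using assms(1)
proof (induction rule: cmat.span_induct_alt)
  case base
  have "0 ** Y = 0" by (simp add: vec_eq_iff matrix_matrix_mult_def)
  then show ?case by (simp add: cmat.span_zero)
next
  case (step c C X)
  have "C ** Y \<in> cmat.span U"
    using assms(2)
  proof (induction rule: cmat.span_induct_alt)
    case base
    have "C ** 0 = 0" by (simp add: vec_eq_iff matrix_matrix_mult_def)
    then show ?case by (simp add: cmat.span_zero)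
  next
    case (step d D Y)
    then show ?case using prod[OF \<open>C \<in> S\<close>]
      by (simp add: matrix_linear_simps cmat.span_add cmat.span_scale)
  qed
  then show ?case using step by (simp add: matrix_linear_simps cmat.span_add cmat.span_scale)
qed

lemma hadamard_nth [simp]: "hadamard X Y $ i $ j = X $ i $ j * Y $ i $ j"
  by (simp add: hadamard_def)

lemma all_ones_block:
  "(all_ones :: complex^('m::finite + 'n::finite)^('m + 'n)) =
    block_matrix all_ones all_ones all_ones all_ones"
  by (rule block_matrix_eqI) simp_all

context block_extension
begin

text \<open>The nine relations on the points and blocks: equality and inequality of points, incidence and
  non-incidence in both directions, and equality, adjacency and non-adjacency of blocks.\<close>

definition colour :: "'p + 'b \<Rightarrow> 'p + 'b \<Rightarrow> nat" where
  "colour s t =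
    (case s of
       Inl p \<Rightarrow> (case t of Inl q \<Rightarrow> if p = q then 0 else 1 | Inr j \<Rightarrow> if p \<in> Q j then 2 else 3)
     | Inr i \<Rightarrow> (case t of Inl q \<Rightarrow> if q \<in> Q i then 4 else 5
         | Inr j \<Rightarrow> if i = j then 6 else if block_graph x Q i j then 7 else 8))"

text \<open>The matrices that are constant on each of the nine relations.\<close>

definition colour_algebra :: "(complex^('p + 'b)^('p + 'b)) set" where
  "colour_algebra = {X. \<exists>g. \<forall>s t. X $ s $ t = g (colour s t)}"

text \<open>In block form, where closure under multiplication follows from the product formulas for \<open>M\<close>
  and \<open>B\<close>.\<close>

lemma colour_algebra_block_iff:
  "X \<in> colour_algebra \<longleftrightarrow> (\<exists>C D E F. X = block_matrix C D E F \<and>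
     C \<in> cmat.span {mat 1, all_ones} \<and> D \<in> cmat.span {M, all_ones} \<and>
     E \<in> cmat.span {transpose M, all_ones} \<and> F \<in> cmat.span {mat 1, B, all_ones})"
proof
  assume "X \<in> colour_algebra"
  then obtain g where g: "X $ s $ t = g (colour s t)" for s t by (auto simp: colour_algebra_def)
  have "X = block_matrix (cscale (g 0 - g 1) (mat 1) + cscale (g 1) all_ones)
      (cscale (g 2 - g 3) M + cscale (g 3) all_ones)
      (cscale (g 4 - g 5) (transpose M) + cscale (g 5) all_ones)
      (cscale (g 6 - g 8) (mat 1) + cscale (g 7 - g 8) B + cscale (g 8) all_ones)"
    by (rule block_matrix_eqI) (simp_all add: g colour_def)
  then show "\<exists>C D E F. X = block_matrix C D E F \<and>
     C \<in> cmat.span {mat 1, all_ones} \<and> D \<in> cmat.span {M, all_ones} \<and>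
     E \<in> cmat.span {transpose M, all_ones} \<and> F \<in> cmat.span {mat 1, B, all_ones}"
    unfolding span_pair span_triple by blast
next
  assume "\<exists>C D E F. X = block_matrix C D E F \<and>
     C \<in> cmat.span {mat 1, all_ones} \<and> D \<in> cmat.span {M, all_ones} \<and>
     E \<in> cmat.span {transpose M, all_ones} \<and> F \<in> cmat.span {mat 1, B, all_ones}"
  then obtain a a' c c' d d' e e' e'' where X: "X = block_matrix
      (cscale a (mat 1) + cscale a' all_ones) (cscale c M + cscale c' all_ones)
      (cscale d (transpose M) + cscale d' all_ones)
      (cscale e (mat 1) + cscale e' B + cscale e'' all_ones)"
    unfolding span_pair span_triple by blast
  define g :: "nat \<Rightarrow> complex" where
    "g = (\<lambda>n. [a + a', a', c + c', c', d + d', d', e + e'', e' + e'', e''] ! n)"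
  have "X $ s $ t = g (colour s t)" for s t
    by (cases s; cases t) (simp_all add: X g_def colour_def)
  then show "X \<in> colour_algebra" unfolding colour_algebra_def by blast
qed

lemma block_adjacency_mult_transpose:
  "B ** transpose M = cscale (of_real \<psi>) (transpose M) + cscale (of_real \<beta>) all_ones"
proof -
  have "B ** transpose M = transpose (M ** B)"
    by (simp only: matrix_transpose_mul transpose_block_adjacency)
  then show ?thesis by (simp add: incidence_mult_block_adjacency vec_eq_iff)
qed

lemmas product_simps =
  incidence_mult_transpose transpose_mult_incidence incidence_mult_ones ones_mult_incidence
  transpose_incidence_mult_ones ones_mult_transpose_incidence incidence_mult_block_adjacency
  block_adjacency_mult_transpose block_adjacency_square block_adjacency_mult_ones
  ones_mult_block_adjacency all_ones_mult_all_ones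

lemma colour_algebra_mult:
  assumes "X \<in> colour_algebra" and "Y \<in> colour_algebra"
  shows "X ** Y \<in> colour_algebra"
proof -
  obtain C D E F where X: "X = block_matrix C D E F"
    "C \<in> cmat.span {mat 1, all_ones}" "D \<in> cmat.span {M, all_ones}"
    "E \<in> cmat.span {transpose M, all_ones}" "F \<in> cmat.span {mat 1, B, all_ones}"
    using assms(1) unfolding colour_algebra_block_iff by blast
  obtain C' D' E' F' where Y: "Y = block_matrix C' D' E' F'"
    "C' \<in> cmat.span {mat 1, all_ones}" "D' \<in> cmat.span {M, all_ones}"
    "E' \<in> cmat.span {transpose M, all_ones}" "F' \<in> cmat.span {mat 1, B, all_ones}"
    using assms(2) unfolding colour_algebra_block_iff by blast
  have in_span: "C ** C' \<in> cmat.span {mat 1, all_ones}" "D ** E' \<in> cmat.span {mat 1, all_ones}"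
    "C ** D' \<in> cmat.span {M, all_ones}" "D ** F' \<in> cmat.span {M, all_ones}"
    "E ** C' \<in> cmat.span {transpose M, all_ones}" "F ** E' \<in> cmat.span {transpose M, all_ones}"
    "E ** D' \<in> cmat.span {mat 1, B, all_ones}" "F ** F' \<in> cmat.span {mat 1, B, all_ones}"
    by (rule matrix_mult_in_span[OF X(2) Y(2)] matrix_mult_in_span[OF X(3) Y(4)]
        matrix_mult_in_span[OF X(2) Y(3)] matrix_mult_in_span[OF X(3) Y(5)]
        matrix_mult_in_span[OF X(4) Y(2)] matrix_mult_in_span[OF X(5) Y(4)]
        matrix_mult_in_span[OF X(4) Y(3)] matrix_mult_in_span[OF X(5) Y(5)];
        (elim insertE emptyE; simp only: product_simps matrix_mul_lid matrix_mul_rid;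
          intro cmat.span_add cmat.span_scale cmat.span_base; simp))+
  then show ?thesis
    unfolding X(1) Y(1) block_matrix_mult colour_algebra_block_iff
    by (blast intro: cmat.span_add)
qed

lemma coherent_algebra_colour_algebra: "coherent_algebra colour_algebra"
  unfolding coherent_algebra_def
proof (intro conjI ballI)
  show "cmat.subspace colour_algebra"
  proof (rule cmat.subspaceI)
    show "0 \<in> colour_algebra" by (auto simp: colour_algebra_def intro!: exI[of _ "\<lambda>_. 0"])
  next
    fix X Y assume "X \<in> colour_algebra" "Y \<in> colour_algebra"
    then obtain g h where "\<forall>s t. X $ s $ t = g (colour s t)" "\<forall>s t. Y $ s $ t = h (colour s t)"
      by (auto simp: colour_algebra_def)
    then show "X + Y \<in> colour_algebra"
      by (auto simp: colour_algebra_def intro!: exI[of _ "\<lambda>c. g c + h c"])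
  next
    fix a X assume "X \<in> colour_algebra"
    then obtain g where "\<forall>s t. X $ s $ t = g (colour s t)" by (auto simp: colour_algebra_def)
    then show "cscale a X \<in> colour_algebra"
      by (auto simp: colour_algebra_def intro!: exI[of _ "\<lambda>c. a * g c"])
  qed
  have "(mat 1 :: complex^('p + 'b)^('p + 'b)) $ s $ t = (if colour s t \<in> {0, 6} then 1 else 0)" for s t
    by (cases s; cases t) (simp_all add: colour_def)
  then show "mat 1 \<in> colour_algebra" unfolding colour_algebra_def
    by (intro CollectI exI[of _ "\<lambda>c. if c \<in> {0, 6} then 1 else 0"]) blast
  show "all_ones \<in> colour_algebra"
    by (auto simp: colour_algebra_def intro!: exI[of _ "\<lambda>_. 1"])
next
  fix X assume "X \<in> colour_algebra"
  then obtain g where g: "\<forall>s t. X $ s $ t = g (colour s t)" by (auto simp: colour_algebra_def)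
  \<comment> \<open>Transposition exchanges the two directions of incidence and of non-incidence.\<close>
  have "colour t s = [0, 1, 4, 5, 2, 3, 6, 7, 8] ! colour s t" for s t
    by (cases s; cases t) (simp_all add: colour_def block_graph_def Int_commute)
  then have "transpose X $ s $ t = g ([0, 1, 4, 5, 2, 3, 6, 7, 8] ! colour s t)" for s t
    unfolding transpose_nth using g by metis
  then show "transpose X \<in> colour_algebra" unfolding colour_algebra_def
    by (intro CollectI exI[of _ "\<lambda>c. g ([0, 1, 4, 5, 2, 3, 6, 7, 8] ! c)"]) blast
next
  fix X Y assume XY: "X \<in> colour_algebra" "Y \<in> colour_algebra"
  then show "X ** Y \<in> colour_algebra" by (rule colour_algebra_mult)
  obtain g h where "\<forall>s t. X $ s $ t = g (colour s t)" "\<forall>s t. Y $ s $ t = h (colour s t)"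
    using XY by (auto simp: colour_algebra_def)
  then show "hadamard X Y \<in> colour_algebra"
    by (auto simp: colour_algebra_def intro!: exI[of _ "\<lambda>c. g c * h c"])
qed

lemma W_in_colour_algebra: "W \<in> colour_algebra"
proof -
  have "W $ s $ t = (if colour s t = 1 then of_real \<kappa> else if colour s t \<in> {2, 4, 7} then 1 else 0)" for s t
    by (cases s; cases t) (auto simp: W_def colour_def)
  then show ?thesis unfolding colour_algebra_def
    by (intro CollectI exI[of _ "\<lambda>c. if c = 1 then of_real \<kappa> else if c \<in> {2, 4, 7} then 1 else 0"]) blast
qed

lemma point_adjacency_mult_ones:
  "cscale (of_real \<kappa>) (all_ones - mat 1 :: complex^'p^'p) ** all_ones = cscale (of_real \<delta>) all_ones"
  by (simp add: vec_eq_iff matrix_matrix_mult_def sum_subtractf card_points \<delta>_def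
      flip: sum_distrib_left)

lemma W_mult_ones:
  "(W ** (all_ones :: complex^('p + 'b)^('p + 'b))) $ s $ t =
    (case s of Inl _ \<Rightarrow> of_real (\<delta> + real r) | Inr _ \<Rightarrow> of_real (real k + e\<^sub>0))"
  unfolding W_def all_ones_block block_matrix_mult
  by (cases s; cases t)
    (simp_all del: incidence_nth block_adjacency_nth add: point_adjacency_mult_ones incidence_mult_ones
      transpose_incidence_mult_ones block_adjacency_mult_ones)

text \<open>When the points and the blocks have different degrees, these degrees separate points from
  blocks in the coherent closure, and the nine relations can be cut out of \<open>W\<close>.\<close>

lemma colour_algebra_minimal:
  assumes coh: "coherent_algebra \<B>" and W: "W \<in> \<B>" and neq: "\<delta> + real r \<noteq> real k + e\<^sub>0"
  shows "colour_algebra \<subseteq> \<B>"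
proof
  have sub: "cmat.subspace \<B>" and one: "mat 1 \<in> \<B>" and J: "all_ones \<in> \<B>"
    and mult: "\<And>X Y. X \<in> \<B> \<Longrightarrow> Y \<in> \<B> \<Longrightarrow> X ** Y \<in> \<B>"
    and had: "\<And>X Y. X \<in> \<B> \<Longrightarrow> Y \<in> \<B> \<Longrightarrow> hadamard X Y \<in> \<B>"
    using coh unfolding coherent_algebra_def by blast+
  note add = cmat.subspace_add[OF sub] and scale = cmat.subspace_scale[OF sub]
    and diff = cmat.subspace_diff[OF sub]
  \<comment> \<open>The diagonal of \<open>W ** all_ones\<close> yields the projections to the points and to the blocks.\<close>
  define D :: "complex^('p + 'b)^('p + 'b)" where "D = block_matrix (mat 1) 0 0 0"
  define D' :: "complex^('p + 'b)^('p + 'b)" where "D' = block_matrix 0 0 0 (mat 1)"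
  have "D = cscale (inverse (of_real (\<delta> + real r) - of_real (real k + e\<^sub>0)))
      (hadamard (mat 1) (W ** all_ones) - cscale (of_real (real k + e\<^sub>0)) (mat 1))"
  proof -
    have "complex_of_real (\<delta> + real r) - of_real (real k + e\<^sub>0) \<noteq> 0"
      using neq unfolding right_minus_eq of_real_eq_iff .
    then show ?thesis
      by (intro block_matrix_eqI) (simp_all del: of_real_add add: D_def W_mult_ones)
  qed
  then have D: "D \<in> \<B>" using one J W by (simp only: scale diff had mult)
  have "D' = mat 1 - D" by (intro block_matrix_eqI) (simp_all add: D_def D'_def)
  then have D': "D' \<in> \<B>" using D one by (simp only: diff)
  have blocks: "D ** all_ones ** D = block_matrix all_ones 0 0 0"
    "D ** all_ones ** D' = block_matrix 0 all_ones 0 0"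
    "D' ** all_ones ** D = block_matrix 0 0 all_ones 0"
    "D' ** all_ones ** D' = block_matrix 0 0 0 all_ones"
    unfolding D_def D'_def all_ones_block block_matrix_mult
    by simp_all
  have in_\<B>: "block_matrix all_ones 0 0 0 \<in> \<B>" "block_matrix 0 all_ones 0 0 \<in> \<B>"
    "block_matrix 0 0 all_ones 0 \<in> \<B>" "block_matrix 0 0 0 all_ones \<in> \<B>"
    unfolding blocks[symmetric] by (intro mult D D' J)+
  fix X assume "X \<in> colour_algebra"
  then obtain g where g: "X $ s $ t = g (colour s t)" for s t by (auto simp: colour_algebra_def)
  have "X = hadamard (block_matrix all_ones 0 0 0) (cscale (g 0 - g 1) (mat 1) + cscale (g 1) all_ones)
      + hadamard (block_matrix 0 all_ones 0 0) (cscale (g 2 - g 3) W + cscale (g 3) all_ones)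
      + hadamard (block_matrix 0 0 all_ones 0) (cscale (g 4 - g 5) W + cscale (g 5) all_ones)
      + hadamard (block_matrix 0 0 0 all_ones)
          (cscale (g 6 - g 8) (mat 1) + cscale (g 7 - g 8) W + cscale (g 8) all_ones)"
    by (rule block_matrix_eqI) (simp_all add: g colour_def W_def)
  also have "\<dots> \<in> \<B>" by (intro add had scale in_\<B> one J W)
  finally show "X \<in> \<B>" .
qed

lemma range_colour: "range (\<lambda>(s, t). colour s t) = {..<9}"
proof
  have "colour s t < 9" for s t
    by (cases s; cases t) (simp_all add: colour_def)
  then show "range (\<lambda>(s, t). colour s t) \<subseteq> {..<9}" by auto
  have ex: "\<exists>s t. colour s t = n" if "n < 9" for n
  proof -
    obtain i j where ij: "i \<noteq> j" "card (Q i \<inter> Q j) = x" using ex_x by blast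
    obtain i' j' where ij': "i' \<noteq> j'" "card (Q i' \<inter> Q j') = y" using ex_y by blast
    have "Q i \<noteq> {}" using card_block[of i] k_pos by auto
    moreover have "Q i \<noteq> UNIV" using card_block[of i] k_less_v card_points by auto
    ultimately obtain p q where pq: "p \<in> Q i" "q \<notin> Q i" by blast
    have "colour (Inl p) (Inl p) = 0" "colour (Inl p) (Inl q) = 1"
      "colour (Inl p) (Inr i) = 2" "colour (Inl q) (Inr i) = 3"
      "colour (Inr i) (Inl p) = 4" "colour (Inr i) (Inl q) = 5"
      "colour (Inr i) (Inr i) = 6" "colour (Inr i) (Inr j) = 7" "colour (Inr i') (Inr j') = 8"
      using pq ij ij' x_neq_y by (auto simp: colour_def block_graph_def)
    moreover have "n \<in> {0, 1, 2, 3, 4, 5, 6, 7, 8}" using that by auto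
    ultimately show ?thesis by blast
  qed
  show "{..<9} \<subseteq> range (\<lambda>(s, t). colour s t)"
  proof
    fix n :: nat assume "n \<in> {..<9}"
    then have "n < 9" by simp
    then obtain s t where "colour s t = n" using ex[of n] by blast
    then show "n \<in> range (\<lambda>(s, t). colour s t)" by (intro range_eqI[of _ _ "(s, t)"]) simp
  qed
qed

lemma coherent_rank_W_graph:
  assumes E: "adjacency_matrix E = W" and neq: "\<delta> + real r \<noteq> real k + e\<^sub>0"
  shows "coherent_rank E = 9"
proof -
  have "coherent_closure E = colour_algebra"
    unfolding coherent_closure_def E
    using coherent_algebra_colour_algebra W_in_colour_algebra colour_algebra_minimal neq by blast
  then have "coherent_rank E = algebra_rank colour_algebra" by (simp add: coherent_rank_def)
  also have "\<dots> = card (range (\<lambda>(s, t). colour s t))"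
    by (rule algebra_rank_colouring) (simp add: colour_algebra_def)
  finally show ?thesis by (simp add: range_colour)
qed

end

section \<open>Total graphs and whole graphs\<close>

theorem theorem5p9:
  fixes Q :: "'b::finite \<Rightarrow> 'p::finite set"
    and \<theta>\<^sub>1 \<theta>\<^sub>2 :: int
    and v k lam b r x y :: nat
    and e\<^sub>0 e\<^sub>1 e\<^sub>2 :: real
  assumes "\<theta>\<^sub>1 \<ge> 1" and "\<theta>\<^sub>2 \<le> -2"
    and "QSD Q v k lam b r x y"
    and "block_graph x Q \<in> G3 e\<^sub>0 e\<^sub>1 e\<^sub>2"
    and "real x = real k + (real_of_int \<theta>\<^sub>1 + 1) * (real_of_int \<theta>\<^sub>2 + 1) - (e\<^sub>1 + 1) * (e\<^sub>2 + 1)"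
    and "real y = real k + real_of_int \<theta>\<^sub>1 * real_of_int \<theta>\<^sub>2 - e\<^sub>1 * e\<^sub>2"
  shows
    "(int lam = int r + \<theta>\<^sub>1 * \<theta>\<^sub>2 \<and>
      (real r - real lam + real y - real k) / (real x - real y)
        = real_of_int \<theta>\<^sub>1 + real_of_int \<theta>\<^sub>2 \<and>
      (real lam * real k - real y * real r) / (real x - real y)
        = sqrt (real lam * (real k + e\<^sub>0 + real_of_int \<theta>\<^sub>1 * real_of_int \<theta>\<^sub>2))
      \<longrightarrow>
      total_graph x Q \<in> G3 (e\<^sub>0 - real_of_int \<theta>\<^sub>2) (real_of_int \<theta>\<^sub>1) (real_of_int \<theta>\<^sub>2) \<and>
      (real r \<noteq> real k + e\<^sub>0 \<longrightarrow> coherent_rank (total_graph x Q) = 9))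
   \<and>
     (int lam = int r + (\<theta>\<^sub>1 + 1) * (\<theta>\<^sub>2 + 1) \<and>
      (real r - real lam + real y - real k) / (real x - real y)
        = real_of_int \<theta>\<^sub>1 + real_of_int \<theta>\<^sub>2 + 1 \<and>
      real k + (real lam * real k - real y * real r) / (real x - real y)
        = sqrt ((real v - 1 + real r + real_of_int \<theta>\<^sub>1 * real_of_int \<theta>\<^sub>2)
                * (real k + e\<^sub>0 + real_of_int \<theta>\<^sub>1 * real_of_int \<theta>\<^sub>2))
      \<longrightarrow>
      whole_graph x Q \<in>
        G3 ((real v - 1 + e\<^sub>0 + sqrt ((real v - 1 - e\<^sub>0)\<^sup>2 + 4 * real r * real k)) / 2)
           (real_of_int \<theta>\<^sub>1) (real_of_int \<theta>\<^sub>2) \<and>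
      (real v - 1 + real r \<noteq> real k + e\<^sub>0 \<longrightarrow> coherent_rank (whole_graph x Q) = 9))"
proof (intro conjI impI; elim conjE)
  interpret quasi_symmetric_design Q v k lam b r x y
    using assms(3) by unfold_locales
  interpret strongly_regular_design Q v k lam b r x y e\<^sub>0 e\<^sub>1 e\<^sub>2
    using assms(4) by unfold_locales
  have theta: "real_of_int \<theta>\<^sub>1 \<ge> 1" "real_of_int \<theta>\<^sub>2 \<le> - 2" using assms(1,2) by linarith+
  {
    assume lam: "int lam = int r + \<theta>\<^sub>1 * \<theta>\<^sub>2"
      and psi: "(real r - real lam + real y - real k) / (real x - real y)
        = real_of_int \<theta>\<^sub>1 + real_of_int \<theta>\<^sub>2"
      and beta: "(real lam * real k - real y * real r) / (real x - real y)
        = sqrt (real lam * (real k + e\<^sub>0 + real_of_int \<theta>\<^sub>1 * real_of_int \<theta>\<^sub>2))"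
    have lam': "real lam = real r + real_of_int \<theta>\<^sub>1 * real_of_int \<theta>\<^sub>2"
      using arg_cong[OF lam, of real_of_int] by simp
    interpret block_extension Q v k lam b r x y e\<^sub>0 e\<^sub>1 e\<^sub>2 0 "real_of_int \<theta>\<^sub>1" "real_of_int \<theta>\<^sub>2"
    proof unfold_locales
      show "\<psi> = real_of_int \<theta>\<^sub>1 + real_of_int \<theta>\<^sub>2 + 0" using psi by (simp add: \<psi>_def)
      show "0 * real k + \<beta> = sqrt ((0 * (real v - 1) + real r + real_of_int \<theta>\<^sub>1 * real_of_int \<theta>\<^sub>2)
          * (real k + e\<^sub>0 + real_of_int \<theta>\<^sub>1 * real_of_int \<theta>\<^sub>2))"
        using beta unfolding \<beta>_def lam' by simp
    qed (use theta assms(5,6) lam' in simp_all)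
    have W: "adjacency_matrix (total_graph x Q) = W"
      unfolding adjacency_matrix_total_graph total_matrix_def W_def
      by (rule block_matrix_eqI) simp_all
    show "total_graph x Q \<in> G3 (e\<^sub>0 - real_of_int \<theta>\<^sub>2) (real_of_int \<theta>\<^sub>1) (real_of_int \<theta>\<^sub>2)"
      using W_graph_in_G3[OF W] theta0_total by simp
    show "coherent_rank (total_graph x Q) = 9" if "real r \<noteq> real k + e\<^sub>0"
      using coherent_rank_W_graph[OF W] that by (simp add: \<delta>_def)
  next
    assume lam: "int lam = int r + (\<theta>\<^sub>1 + 1) * (\<theta>\<^sub>2 + 1)"
      and psi: "(real r - real lam + real y - real k) / (real x - real y)
        = real_of_int \<theta>\<^sub>1 + real_of_int \<theta>\<^sub>2 + 1"
      and beta: "real k + (real lam * real k - real y * real r) / (real x - real y)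
        = sqrt ((real v - 1 + real r + real_of_int \<theta>\<^sub>1 * real_of_int \<theta>\<^sub>2)
                * (real k + e\<^sub>0 + real_of_int \<theta>\<^sub>1 * real_of_int \<theta>\<^sub>2))"
    have lam': "real lam = real r + (real_of_int \<theta>\<^sub>1 + 1) * (real_of_int \<theta>\<^sub>2 + 1)"
      using arg_cong[OF lam, of real_of_int] by simp
    interpret block_extension Q v k lam b r x y e\<^sub>0 e\<^sub>1 e\<^sub>2 1 "real_of_int \<theta>\<^sub>1" "real_of_int \<theta>\<^sub>2"
    proof unfold_locales
      show "\<psi> = real_of_int \<theta>\<^sub>1 + real_of_int \<theta>\<^sub>2 + 1" using psi by (simp add: \<psi>_def)
      show "1 * real k + \<beta> = sqrt ((1 * (real v - 1) + real r + real_of_int \<theta>\<^sub>1 * real_of_int \<theta>\<^sub>2)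
          * (real k + e\<^sub>0 + real_of_int \<theta>\<^sub>1 * real_of_int \<theta>\<^sub>2))"
        using beta unfolding \<beta>_def by simp
    qed (use theta assms(5,6) lam' in simp_all)
    have W: "adjacency_matrix (whole_graph x Q) = W"
      unfolding adjacency_matrix_whole_graph whole_matrix_def W_def
      by (rule block_matrix_eqI) simp_all
    show "whole_graph x Q \<in>
        G3 ((real v - 1 + e\<^sub>0 + sqrt ((real v - 1 - e\<^sub>0)\<^sup>2 + 4 * real r * real k)) / 2)
           (real_of_int \<theta>\<^sub>1) (real_of_int \<theta>\<^sub>2)"
      using W_graph_in_G3[OF W] by (simp add: \<theta>\<^sub>0_def \<delta>_def)
    show "coherent_rank (whole_graph x Q) = 9" if "real v - 1 + real r \<noteq> real k + e\<^sub>0"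
      using coherent_rank_W_graph[OF W] that by (simp add: \<delta>_def)
  }
qed

end
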